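(* Let $\sigma\in[0,1/2]$, $0\le\xi\le1$, $\alpha\ge0$, $\gamma>0$, and let $\mu\ge 1$, $\nu>0$ satisfy $\mu+\nu=\alpha-\gamma$, $\mu\nu=\gamma$. Let $\lambda$ be a non-negative integrable function on $[0,1]$ with $\int_0^1\lambda(t)\,dt=1$, and assume that $\Lambda_\nu$ and $\Pi_{\mu,\nu}$ are integrable on $[0,1]$ and positive on $(0,1)$. Suppose that $\beta<1$ satisfies $$\frac{\beta}{1-\beta}=-\int_0^1\lambda(t)\bigl((1-\xi)g(t)+\xi(2q(t)-1)\bigr)\,dt$$ and that the function $$t\longmapsto \frac{\xi\, t^{1/\xi-1/\mu+1}\,\dfrac{d}{dt}\left(t^{1/\mu-1/\xi}\,\Pi_{\mu,\nu}(t)\right)}{\left(\log(1/t)\right)^{1+2\sigma}}$$ is increasing on $(0,1)$ (for $\xi=0$ the numerator is read as $-\Pi_{\mu,\nu}(t)$, the value at $\xi=0$ of the expanded numerator $(\xi/\mu-1)\Pi_{\mu,\nu}(t)+\xi t\,\Pi_{\mu,\nu}'(t)$). Then $V_\lambda(\mathcal W_\beta(\alpha,\gamma))\subset M(\sigma,\xi)$.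
   Context: $\mathbb D=\{z\in\mathbb C:|z|<1\}$. $\mathcal A$ is the class of analytic functions $f$ on $\mathbb D$ with $f(0)=f'(0)-1=0$. The Pascu class $M(\sigma,\xi)$ ($0\le\sigma<1$, $0\le\xi\le1$) is the class of $f\in\mathcal A$ with $$\mathrm{Re}\,\frac{\xi z(zf'(z))'+(1-\xi)zf'(z)}{\xi zf'(z)+(1-\xi)f(z)}>\sigma,\quad z\in\mathbb D,$$ equivalently $\xi zf'+(1-\xi)f$ is starlike of order $\sigma$ (univalent on $\mathbb D$ and $K=\xi zf'+(1-\xi)f$ satisfies $\mathrm{Re}(zK'/K)>\sigma$). For $\alpha,\gamma\ge0$, $\beta<1$, $\mathcal W_\beta(\alpha,\gamma)$ is the class of $f\in\mathcal A$ for which there is $\phi\in\mathbb R$ with $$\mathrm{Re}\left(e^{i\phi}\left((1-\alpha+2\gamma)\tfrac{f(z)}{z}+(\alpha-2\gamma)f'(z)+\gamma zf''(z)-\beta\right)\right)>0,\quad z\in\mathbb D.$$ $V_\lambda(f)(z)=\int_0^1\lambda(t)\frac{f(tz)}{t}\,dt$. The functions $g,q$ on $[0,1]$ are $$g(t)=\frac{2}{\mu\nu}\int_0^1\!\!\int_0^1\frac{1-\sigma(1+swt)}{(1-\sigma)(1+swt)^2}s^{1/\mu-1}w^{1/\nu-1}\,ds\,dw-1,$$ $$q(t)=\frac{1}{\mu\nu}\int_0^1\!\!\int_0^1\frac{1-\sigma-(1+\sigma)swt}{(1-\sigma)(1+swt)^3}s^{1/\mu-1}w^{1/\nu-1}\,ds\,dw.$$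 $\Lambda_\nu(t)=\int_t^1\frac{\lambda(x)}{x^{1/\nu}}\,dx$ and $\Pi_{\mu,\nu}(t)=\int_t^1\Lambda_\nu(x)x^{1/\nu-1-1/\mu}\,dx$. *)

theory Defs
  imports "HOL-Analysis.Analysis"
begin

text \<open>Functions on the unit disc are total functions on \<^typ>\<open>complex\<close>; every class below constrains
  them on \<^term>\<open>ball (0::complex) 1\<close> only.\<close>

definition class_A :: "(complex \<Rightarrow> complex) set" where
  "class_A = {f. f holomorphic_on ball 0 1 \<and> f 0 = 0 \<and> deriv f 0 = 1}"

text \<open>The quotient in the Pascu class has a removable singularity at \<open>z = 0\<close> with value \<open>1 > \<sigma>\<close>, so
  the condition there is vacuous and the origin is left out. Elsewhere the denominator has to be
  non-zero for the quotient to make sense.\<close>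

definition pascu_class :: "real \<Rightarrow> real \<Rightarrow> (complex \<Rightarrow> complex) set" where
  "pascu_class \<sigma> \<xi> = {f \<in> class_A. \<forall>z \<in> ball 0 1 - {0}.
     of_real \<xi> * z * deriv f z + of_real (1 - \<xi>) * f z \<noteq> 0 \<and>
     Re ((of_real \<xi> * z * deriv (\<lambda>w. w * deriv f w) z + of_real (1 - \<xi>) * z * deriv f z) /
         (of_real \<xi> * z * deriv f z + of_real (1 - \<xi>) * f z)) > \<sigma>}"

text \<open>The analytic function \<open>f(z)/z\<close>, with its removable singularity at the origin filled in.\<close>

definition div_z :: "(complex \<Rightarrow> complex) \<Rightarrow> complex \<Rightarrow> complex" where
  "div_z f z = (if z = 0 then deriv f 0 else f z / z)"

definition class_W :: "real \<Rightarrow> real \<Rightarrow> real \<Rightarrow> (complex \<Rightarrow> complex) set" where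
  "class_W \<beta> \<alpha> \<gamma> = {f \<in> class_A. \<exists>\<phi>::real. \<forall>z \<in> ball 0 1.
     Re (exp (\<i> * of_real \<phi>) *
       (of_real (1 - \<alpha> + 2 * \<gamma>) * div_z f z + of_real (\<alpha> - 2 * \<gamma>) * deriv f z
        + of_real \<gamma> * z * (deriv ^^ 2) f z - of_real \<beta>)) > 0}"

definition V_transform :: "(real \<Rightarrow> real) \<Rightarrow> (complex \<Rightarrow> complex) \<Rightarrow> complex \<Rightarrow> complex" where
  "V_transform lam f z =
     (LINT t:{0..1}|lebesgue. of_real (lam t) * (f (of_real t * z) / of_real t))"

definition g_fun :: "real \<Rightarrow> real \<Rightarrow> real \<Rightarrow> real \<Rightarrow> real" where
  "g_fun \<sigma> \<mu> \<nu> t = 2 / (\<mu> * \<nu>) *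
     (LINT w:{0..1}|lebesgue. LINT s:{0..1}|lebesgue.
        (1 - \<sigma> * (1 + s * w * t)) / ((1 - \<sigma>) * (1 + s * w * t) ^ 2)
          * s powr (1 / \<mu> - 1) * w powr (1 / \<nu> - 1)) - 1"

definition q_fun :: "real \<Rightarrow> real \<Rightarrow> real \<Rightarrow> real \<Rightarrow> real" where
  "q_fun \<sigma> \<mu> \<nu> t = 1 / (\<mu> * \<nu>) *
     (LINT w:{0..1}|lebesgue. LINT s:{0..1}|lebesgue.
        (1 - \<sigma> - (1 + \<sigma>) * s * w * t) / ((1 - \<sigma>) * (1 + s * w * t) ^ 3)
          * s powr (1 / \<mu> - 1) * w powr (1 / \<nu> - 1))"

definition Lambda_fun :: "(real \<Rightarrow> real) \<Rightarrow> real \<Rightarrow> real \<Rightarrow> real" where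
  "Lambda_fun lam \<nu> t = (LINT x:{t..1}|lebesgue. lam x / x powr (1 / \<nu>))"

definition Pi_fun :: "(real \<Rightarrow> real) \<Rightarrow> real \<Rightarrow> real \<Rightarrow> real \<Rightarrow> real" where
  "Pi_fun lam \<mu> \<nu> t = (LINT x:{t..1}|lebesgue. Lambda_fun lam \<nu> x * x powr (1 / \<nu> - 1 - 1 / \<mu>))"

text \<open>For \<open>\<xi> > 0\<close> the product rule expands this to \<open>(\<xi>/\<mu> - 1) \<Pi>(t) + \<xi> t \<Pi>'(t)\<close>; the case \<open>\<xi> = 0\<close>
  is the value of that expansion.\<close>

definition Pi_numerator :: "(real \<Rightarrow> real) \<Rightarrow> real \<Rightarrow> real \<Rightarrow> real \<Rightarrow> real \<Rightarrow> real" where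
  "Pi_numerator lam \<mu> \<nu> \<xi> t =
     (if \<xi> = 0 then - Pi_fun lam \<mu> \<nu> t
      else \<xi> * t powr (1 / \<xi> - 1 / \<mu> + 1)
             * deriv (\<lambda>x. x powr (1 / \<mu> - 1 / \<xi>) * Pi_fun lam \<mu> \<nu> x) t)"

end

theory Submission
  imports Defs "HOL-Complex_Analysis.Cauchy_Integral_Formula" "HOL-Real_Asymp.Real_Asymp"
begin

text \<open>
  Put \<open>F = V\<^sub>\<lambda> f\<close> and \<open>K = \<xi> z F' + (1 - \<xi>) F\<close>. Off the zeros of \<open>K\<close>, the quotient \<open>z K' / K\<close>
  takes a value on the line \<open>Re = \<sigma>\<close> exactly where the Hadamard product of \<open>K\<close> with one of the functions
  \<open>h\<^sub>\<epsilon>(u) = u (1 + (\<epsilon> + 2\<sigma> - 1) u / (2 - 2\<sigma>)) / (1 - u)\<^sup>2\<close>, \<open>|\<epsilon>| = 1\<close>, vanishes;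
  for \<open>\<epsilon> = -1\<close> this product is \<open>K\<close> itself. As the quotient is \<open>1\<close> at
  the origin and the disc is connected, \<open>F\<close> lies in the Pascu class as soon as all these products are
  zero-free off the origin (\<open>pascu_class_of_nonvanishing\<close>).

  Since \<open>\<mu> + \<nu> = \<alpha> - \<gamma>\<close> and \<open>\<mu> \<nu> = \<gamma>\<close>, the expression that defines the class W multiplies the
  coefficient of \<open>z\<^sup>m\<close> in \<open>f(z)/z\<close> by \<open>(1 + \<mu>m)(1 + \<nu>m)\<close>. Two integrations (Fubini,
  \<open>tail_integral_fubini\<close>) identify the numbers \<open>(1 + \<xi>m) \<integral>\<lambda>(t) t\<^sup>m dt / ((1 + \<mu>m)(1 + \<nu>m))\<close> as
  \<open>1/(\<mu>\<nu>)\<close> times the moments of the weight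
  \<open>W(t) = (1 - \<xi>/\<mu>) t\<^bsup>1/\<mu>-1\<^esup> \<Pi>(t) + \<xi> t\<^bsup>1/\<nu>-1\<^esup> \<Lambda>(t)\<close>. So \<open>(K * h\<^sub>\<epsilon>)(z) / z\<close> is the Hadamard product of
  a function with positive real part (after a rotation) and
  \<open>Q(u) = \<beta>/(1-\<beta>) + 1/(\<mu>\<nu>) \<integral> W(t) h\<^sub>\<epsilon>(tu)/(tu) dt\<close>. Such a product is zero-free when
  \<open>Re Q \<ge> Q(0)/2\<close> (\<open>hadamard_product_real_part_pos\<close>, the positivity behind duality theory), and the
  equation for \<open>\<beta>\<close> says precisely that this amounts to
  \<open>\<integral> W(t) (Re (h\<^sub>\<epsilon>(tu)/(tu)) - B(t)) dt \<ge> 0\<close>, where \<open>B(t)\<close> is the value of \<open>h\<^sub>1(u)/u\<close> at \<open>u = -t\<close>.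

  This integral inequality is \<open>integral_starlike_kernel_ge\<close>. On \<open>(0,1)\<close> the weight is
  \<open>t\<^bsup>1/\<mu>-1\<^esup>\<close> times the negative of the numerator in the monotonicity hypothesis, so that
  \<open>W(t) = k(t) log(1/t)\<close> with \<open>k\<close> non-negative and non-increasing, by \<open>\<mu> \<ge> 1\<close> and \<open>\<sigma> \<ge> 0\<close>. Taking the
  worst \<open>\<epsilon>\<close> for each \<open>t\<close> separately, and using \<open>\<sigma> \<le> 1/2\<close> to drop a non-negative term, the bracket is
  bounded below by a non-negative multiple of an explicit rational function \<open>\<phi>(s)\<close>, \<open>s = t|u|\<close>. This
  function changes sign once, from plus to minus, so \<open>k\<close> may be replaced by its value at the sign
  change, and only \<open>\<integral> log(1/t) \<phi>(t|u|) dt \<ge> 0\<close> is left. There the integrand is, up to a factor, the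
  derivative of a function vanishing at both ends plus a term that is non-negative because
  \<open>log(1/s) \<le> (1 - s\<^sup>2)/(2s)\<close>.
\<close>

section \<open>The extremal kernel for starlikeness of order sigma\<close>

lemma set_integrable_mult_continuous:
  fixes g :: "real \<Rightarrow> 'b::euclidean_space"
  assumes "set_integrable lebesgue {a..b} W" "continuous_on {a..b} g"
  shows "set_integrable lebesgue {a..b} (\<lambda>t. W t *\<^sub>R g t)"
proof (rule absolutely_integrable_bounded_measurable_product[where h = "\<lambda>x y. y *\<^sub>R x"])
  show "bilinear (\<lambda>(x::'b) (y::real). y *\<^sub>R x)"
    by (auto simp: bilinear_def linear_iff algebra_simps)
  show "g \<in> borel_measurable (lebesgue_on {a..b})"
    using assms by (intro continuous_imp_measurable_on_sets_lebesgue) auto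
  show "bounded (g ` {a..b})"
    using assms by (intro compact_imp_bounded compact_continuous_image) auto
qed (use assms in auto)

lemma AE_lebesgue_neq_0_1: "AE t in lebesgue. t \<noteq> (0::real) \<and> t \<noteq> 1"
  by (intro AE_completion) (use AE_lborel_singleton[of "0::real"] AE_lborel_singleton[of "1::real"] in auto)

text \<open>The function \<open>h\<^sub>\<epsilon>(u)/u\<close> that detects starlikeness of order \<open>\<sigma>\<close>, in partial fractions with the
  dependence on \<open>\<epsilon>\<close> isolated in the last term.\<close>

definition starlike_kernel :: "real \<Rightarrow> complex \<Rightarrow> complex \<Rightarrow> complex" where
  "starlike_kernel \<sigma> \<epsilon> u =
     (1 / (1 - u)\<^sup>2 + of_real (1 - 2 * \<sigma>) / (1 - u) + \<epsilon> * u / (1 - u)\<^sup>2) / of_real (2 - 2 * \<sigma>)"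

text \<open>The value of \<open>starlike_kernel \<sigma> 1\<close> at \<open>-t\<close>.\<close>

definition starlike_bound :: "real \<Rightarrow> real \<Rightarrow> real" where
  "starlike_bound \<sigma> t = (1 - \<sigma> * (1 + t)) / ((1 - \<sigma>) * (1 + t)\<^sup>2)"

text \<open>Up to the factor \<open>2 (1 + x) / (2 - 2\<sigma>)\<close>, what remains of
  \<open>Re (starlike_kernel \<sigma> \<epsilon> u) - starlike_bound \<sigma> s\<close> for \<open>|u| = s\<close> and \<open>Re u = s x\<close> after minimising
  over \<open>\<epsilon>\<close> and discarding the part proportional to \<open>1 - 2\<sigma>\<close>.\<close>

definition reduced_kernel :: "real \<Rightarrow> real \<Rightarrow> real" where
  "reduced_kernel x s = s * ((1 - s) / ((1 - 2 * s * x + s\<^sup>2) * (1 + s)\<^sup>2)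
     - s * (1 - x) / (1 - 2 * s * x + s\<^sup>2)\<^sup>2)"

lemma starlike_bound_alt:
  assumes "\<sigma> < 1" "0 \<le> t"
  shows "starlike_bound \<sigma> t = (2 / (1 + t)\<^sup>2 - 2 * \<sigma> / (1 + t)) / (2 - 2 * \<sigma>)"
  using assms by (simp add: starlike_bound_def divide_simps power2_eq_square; simp add: algebra_simps)

lemma starlike_bound_antimono:
  assumes "0 \<le> \<sigma>" "\<sigma> \<le> 1/2" "0 \<le> s" "s \<le> t" "t \<le> 1"
  shows "starlike_bound \<sigma> t \<le> starlike_bound \<sigma> s"
proof -
  define v w where "v = 1 / (1 + t)" and "w = 1 / (1 + s)"
  have v: "1/2 \<le> v" "v \<le> w" using assms by (auto simp: v_def w_def field_simps)
  have "0 \<le> (w - v) * (2 * (w + v) - 2 * \<sigma>)" using v assms by (intro mult_nonneg_nonneg) auto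
  then have "2 * v\<^sup>2 - 2 * \<sigma> * v \<le> 2 * w\<^sup>2 - 2 * \<sigma> * w" by (simp add: algebra_simps power2_eq_square)
  then have "(2 / (1 + t)\<^sup>2 - 2 * \<sigma> / (1 + t)) / (2 - 2 * \<sigma>) \<le> (2 / (1 + s)\<^sup>2 - 2 * \<sigma> / (1 + s)) / (2 - 2 * \<sigma>)"
    using assms by (intro divide_right_mono) (auto simp: v_def w_def power_divide)
  then show ?thesis using assms by (simp add: starlike_bound_alt)
qed

text \<open>With \<open>s = exp (-y)\<close> this is \<open>y \<le> sinh y\<close>.\<close>

lemma ln_recip_le:
  assumes "0 < s" "s \<le> (1::real)"
  shows "2 * s * ln (1 / s) \<le> 1 - s\<^sup>2"
proof -
  define h where "h = (\<lambda>y. (1 / y - y) / 2 + ln y :: real)"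
  have "h 1 \<le> h s"
  proof (rule DERIV_nonpos_imp_nonincreasing[OF assms(2)])
    fix y assume y: "s \<le> y" "y \<le> 1"
    have "(h has_real_derivative (- (1 / y\<^sup>2) - 1) / 2 + 1 / y) (at y)"
      unfolding h_def using y assms by (auto intro!: derivative_eq_intros simp: power2_eq_square)
    moreover have "(- (1 / y\<^sup>2) - 1) / 2 + 1 / y = - (1 / y - 1)\<^sup>2 / 2"
      using y assms by (simp add: power2_eq_square field_simps)
    ultimately show "\<exists>d. DERIV h y :> d \<and> d \<le> 0" by (metis divide_nonpos_pos neg_le_0_iff_le zero_le_power2 zero_less_numeral)
  qed
  then have "0 \<le> (1 / s - s) / 2 + ln s" by (simp add: h_def)
  moreover have "ln (1 / s) = - ln s" using assms by (simp add: ln_div)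
  ultimately have "ln (1 / s) \<le> (1 / s - s) / 2" by linarith
  then have "2 * s * ln (1 / s) \<le> 2 * s * ((1 / s - s) / 2)" using assms by (intro mult_left_mono) auto
  also have "\<dots> = 1 - s\<^sup>2" using assms by (simp add: field_simps power2_eq_square)
  finally show ?thesis .
qed

lemma quad_pos:
  assumes "\<bar>x\<bar> \<le> 1" "0 \<le> s" "s < (1::real)"
  shows "0 < 1 - 2 * s * x + s\<^sup>2"
proof -
  have "s * x \<le> s * 1" using assms by (intro mult_left_mono) auto
  moreover have "0 < (1 - s)\<^sup>2" using assms by simp
  ultimately show ?thesis by (simp add: power2_eq_square algebra_simps)
qed

text \<open>The minimum over \<open>\<epsilon>\<close> only costs the modulus \<open>s / |1 - u|\<^sup>2\<close> of the last term of the kernel. Every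
  other term is rational in \<open>s\<close>, \<open>x\<close> and \<open>D = |1 - u|\<^sup>2\<close>; the difference vanishes for \<open>x = -1\<close>, whence
  the factor \<open>1 + x\<close>, and its part proportional to \<open>1 - 2\<sigma>\<close> is non-negative.\<close>

lemma reduced_kernel_lower_bound:
  assumes \<sigma>: "0 \<le> \<sigma>" "\<sigma> \<le> 1/2" and s: "0 \<le> s" "s < 1"
    and \<zeta>: "norm \<zeta> = 1" and \<epsilon>: "norm \<epsilon> = 1"
  shows "2 * (1 + Re \<zeta>) * reduced_kernel (Re \<zeta>) s / (2 - 2 * \<sigma>)
    \<le> Re (starlike_kernel \<sigma> \<epsilon> (of_real s * \<zeta>)) - starlike_bound \<sigma> s"
proof -
  define x y where "x = Re \<zeta>" and "y = Im \<zeta>"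
  have xy: "x\<^sup>2 + y\<^sup>2 = 1" using \<zeta> by (simp add: x_def y_def cmod_def)
  then have x1: "\<bar>x\<bar> \<le> 1" by (metis abs_le_square_iff abs_one le_add_same_cancel1 one_power2 zero_le_power2)
  define D where "D = 1 - 2 * s * x + s\<^sup>2"
  have D: "D > 0" unfolding D_def using quad_pos[OF x1 s] .
  define u where "u = of_real s * \<zeta>"
  have u: "Re u = s * x" "Im u = s * y" "norm u = s" using \<zeta> s by (auto simp: u_def x_def y_def norm_mult)
  have y2: "y\<^sup>2 = 1 - x\<^sup>2" using xy by simp
  have n2: "(Re (1 - u))\<^sup>2 + (Im (1 - u))\<^sup>2 = D"
    by (simp add: u D_def power2_diff power_mult_distrib y2 algebra_simps)
  then have nD: "(norm (1 - u))\<^sup>2 = D" by (simp add: cmod_power2)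
  have r1: "Re (1 / (1 - u)) = (1 - s * x) / D"
    by (simp only: Re_divide n2) (simp add: u)
  have i1: "Im (1 / (1 - u)) = s * y / D"
    by (simp only: Im_divide n2) (simp add: u)
  have r2: "Re (1 / (1 - u)\<^sup>2) = 1 / D - 2 * s\<^sup>2 * (1 - x\<^sup>2) / D\<^sup>2"
  proof -
    have "Re (1 / (1 - u)\<^sup>2) = (Re (1 / (1 - u)))\<^sup>2 - (Im (1 / (1 - u)))\<^sup>2"
      by (metis Re_power2 power_one_over)
    also have "\<dots> = ((1 - s * x)\<^sup>2 - s\<^sup>2 * y\<^sup>2) / D\<^sup>2"
      unfolding r1 i1 power_divide power_mult_distrib by (simp only: diff_divide_distrib)
    also have "(1 - s * x)\<^sup>2 - s\<^sup>2 * y\<^sup>2 = D - 2 * s\<^sup>2 * (1 - x\<^sup>2)"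
      unfolding y2 D_def by (simp add: power2_eq_square algebra_simps)
    also have "(D - 2 * s\<^sup>2 * (1 - x\<^sup>2)) / D\<^sup>2 = 1 / D - 2 * s\<^sup>2 * (1 - x\<^sup>2) / D\<^sup>2"
      using D by (simp add: diff_divide_distrib power2_eq_square)
    finally show ?thesis .
  qed
  have "norm (\<epsilon> * u / (1 - u)\<^sup>2) = s / D"
    by (simp add: norm_divide norm_mult norm_power \<epsilon> u nD)
  then have r3: "- (s / D) \<le> Re (\<epsilon> * u / (1 - u)\<^sup>2)" using abs_Re_le_cmod[of "\<epsilon> * u / (1 - u)\<^sup>2"] by linarith
  define G where "G = 1 / D - 2 * s\<^sup>2 * (1 - x\<^sup>2) / D\<^sup>2 + (1 - 2 * \<sigma>) * ((1 - s * x) / D) - s / D"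
  have r1': "Re (of_real (1 - 2 * \<sigma>) / (1 - u)) = (1 - 2 * \<sigma>) * ((1 - s * x) / D)"
  proof -
    have "Re (of_real a * w) = a * Re w" for a w by simp
    from this[of "1 - 2 * \<sigma>" "1 / (1 - u)"] show ?thesis by (simp only: r1 times_divide_eq_right mult_1_right)
  qed
  have "G \<le> Re (1 / (1 - u)\<^sup>2 + of_real (1 - 2 * \<sigma>) / (1 - u) + \<epsilon> * u / (1 - u)\<^sup>2)"
    using r3 by (simp only: plus_complex.sel r2 r1' G_def)
  moreover have "Re (starlike_kernel \<sigma> \<epsilon> u) = Re (1 / (1 - u)\<^sup>2 + of_real (1 - 2 * \<sigma>) / (1 - u) + \<epsilon> * u / (1 - u)\<^sup>2) / (2 - 2 * \<sigma>)"
    unfolding starlike_kernel_def by (rule Re_divide_of_real)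
  ultimately have low: "G / (2 - 2 * \<sigma>) \<le> Re (starlike_kernel \<sigma> \<epsilon> u)"
    using \<sigma> by (simp add: divide_right_mono)
  have D2: "D = (1 + s)\<^sup>2 - 2 * s * (1 + x)" by (simp add: D_def power2_eq_square algebra_simps)
  have e1: "1 / D - s / D - (1 - s) / (1 + s)\<^sup>2 = (1 - s) * (2 * s * (1 + x)) / (D * (1 + s)\<^sup>2)"
  proof -
    have "(1 - s) * (2 * s * (1 + x)) / (D * (1 + s)\<^sup>2) = (1 - s) * ((1 + s)\<^sup>2 - D) / (D * (1 + s)\<^sup>2)"
      by (simp add: D2)
    also have "\<dots> = 1 / D - s / D - (1 - s) / (1 + s)\<^sup>2"
      using D s by (simp add: field_simps)
    finally show ?thesis by simp
  qed
  have e2: "(1 - s * x) / D - 1 / (1 + s) = s * (1 + x) * (1 - s) / (D * (1 + s))"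
  proof -
    have "(1 - s * x) * (1 + s) - D = s * (1 + x) * (1 - s)"
      by (simp add: D_def power2_eq_square algebra_simps)
    moreover have "(1 - s * x) / D - 1 / (1 + s) = ((1 - s * x) * (1 + s) - D) / (D * (1 + s))"
      using D s by (simp add: field_simps)
    ultimately show ?thesis by simp
  qed
  have e3: "(1 - s) / (1 + s)\<^sup>2 + (1 - 2 * \<sigma>) / (1 + s) = 2 / (1 + s)\<^sup>2 - 2 * \<sigma> / (1 + s)"
    using s by (simp add: divide_simps power2_eq_square) (simp add: algebra_simps)
  have "G - (2 / (1 + s)\<^sup>2 - 2 * \<sigma> / (1 + s)) =
      (1 / D - s / D - (1 - s) / (1 + s)\<^sup>2) - 2 * s\<^sup>2 * (1 - x\<^sup>2) / D\<^sup>2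
       + (1 - 2 * \<sigma>) * ((1 - s * x) / D - 1 / (1 + s))"
  proof -
    have "2 / (1 + s)\<^sup>2 - 2 * \<sigma> / (1 + s) = (1 - s) / (1 + s)\<^sup>2 + (1 - 2 * \<sigma>) * (1 / (1 + s))"
      by (simp add: e3[symmetric])
    then show ?thesis unfolding G_def right_diff_distrib[of "1 - 2 * \<sigma>"] by linarith
  qed
  also have "\<dots> = 2 * (1 + x) * reduced_kernel x s + (1 - 2 * \<sigma>) * (s * (1 + x) * (1 - s) / (D * (1 + s)))"
  proof -
    define p q where "p = (1 - s) / (D * (1 + s)\<^sup>2)" and "q = s * (1 - x) / D\<^sup>2"
    have "reduced_kernel x s = s * (p - q)"
      by (simp add: reduced_kernel_def D_def p_def q_def)
    moreover have "(1 - s) * (2 * s * (1 + x)) / (D * (1 + s)\<^sup>2) = 2 * (1 + x) * (s * p)"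
      by (simp add: p_def)
    moreover have "2 * s\<^sup>2 * (1 - x\<^sup>2) / D\<^sup>2 = 2 * (1 + x) * (s * q)"
      unfolding q_def by (simp add: power2_eq_square algebra_simps)
    ultimately show ?thesis unfolding e1 e2 by (simp only: right_diff_distrib)
  qed
  also have "\<dots> \<ge> 2 * (1 + x) * reduced_kernel x s"
    using \<sigma> s x1 D by (simp add: mult_nonneg_nonneg)
  finally have "2 * (1 + x) * reduced_kernel x s / (2 - 2 * \<sigma>) \<le> (G - (2 / (1 + s)\<^sup>2 - 2 * \<sigma> / (1 + s))) / (2 - 2 * \<sigma>)"
    using \<sigma> by (intro divide_right_mono) auto
  with low show ?thesis using \<sigma> s starlike_bound_alt[of \<sigma> s]
    unfolding x_def u_def by (simp add: diff_divide_distrib)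
qed

text \<open>For \<open>s > 0\<close> the sign is that of a cubic polynomial in \<open>s\<close>.\<close>

lemma reduced_kernel_factor:
  assumes "\<bar>x\<bar> \<le> 1" "0 \<le> s" "s < 1"
  shows "reduced_kernel x s = s * ((1 - s)^3 + s * (1 - x) * (1 - 4 * s - s\<^sup>2)) /
     ((1 - 2 * s * x + s\<^sup>2)\<^sup>2 * (1 + s)\<^sup>2)"
proof -
  define D where "D = 1 - 2 * s * x + s\<^sup>2"
  have D: "D > 0" unfolding D_def using quad_pos[OF assms] .
  have "(1 - s)^3 + s * (1 - x) * (1 - 4 * s - s\<^sup>2) = (1 - s) * D - s * (1 - x) * (1 + s)\<^sup>2"
    by (simp add: D_def power2_eq_square power3_eq_cube algebra_simps)
  moreover have "reduced_kernel x s = s * ((1 - s) * D - s * (1 - x) * (1 + s)\<^sup>2) / (D\<^sup>2 * (1 + s)\<^sup>2)"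
    unfolding reduced_kernel_def D_def[symmetric] using D assms
    by (simp add: divide_simps) (simp add: power2_eq_square algebra_simps)
  ultimately show ?thesis by (simp add: D_def)
qed

text \<open>In \<open>\<psi>(s)/s = (1 - s)\<^sup>3/s + (1 - x)(1 - 4s - s\<^sup>2)\<close> both summands decrease; the statement clears
  denominators so that \<open>s = 0\<close> is included.\<close>

lemma crossing_poly_ratio_antimono:
  fixes x s t :: real
  defines "\<psi> \<equiv> \<lambda>s. (1 - s)^3 + s * (1 - x) * (1 - 4 * s - s\<^sup>2)"
  assumes "x \<le> 1" "0 \<le> s" "s \<le> t" "t \<le> 1"
  shows "s * \<psi> t \<le> t * \<psi> s"
proof -
  have "s * (1 - t)^3 \<le> t * (1 - s)^3"
    using assms by (intro mult_mono power_mono) auto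
  moreover have "s * t * ((1 - x) * (1 - 4 * t - t\<^sup>2)) \<le> s * t * ((1 - x) * (1 - 4 * s - s\<^sup>2))"
    using assms by (intro mult_left_mono mult_nonneg_nonneg diff_mono power_mono) auto
  ultimately show ?thesis unfolding \<psi>_def by (simp add: algebra_simps)
qed

text \<open>The sign goes from plus to minus at most once. The second alternative covers the case in
  which \<open>r t\<close> stays below the crossing.\<close>

lemma reduced_kernel_crossing:
  assumes "\<bar>x\<bar> \<le> 1" "0 \<le> r" "r < 1"
  obtains t0 where "0 < t0" "t0 < 1" "\<And>t. 0 < t \<Longrightarrow> t \<le> t0 \<Longrightarrow> 0 \<le> reduced_kernel x (r * t)"
      "\<And>t. t0 \<le> t \<Longrightarrow> t < 1 \<Longrightarrow> reduced_kernel x (r * t) \<le> 0"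
  | "\<And>t. 0 < t \<Longrightarrow> t < 1 \<Longrightarrow> 0 \<le> reduced_kernel x (r * t)"
proof -
  define \<psi> where "\<psi> = (\<lambda>s. (1 - s)^3 + s * (1 - x) * (1 - 4 * s - s\<^sup>2))"
  define c where "c = (\<lambda>t. r * t / ((1 - 2 * (r * t) * x + (r * t)\<^sup>2)\<^sup>2 * (1 + r * t)\<^sup>2))"
  have rt: "0 \<le> r * t \<and> r * t < 1" if "0 < t" "t < 1" for t
    using that assms by (metis less_imp_le mult_nonneg_nonneg mult_less_cancel_left1 mult.commute order.strict_trans2 less_eq_real_def mult_left_le not_le)
  have f: "reduced_kernel x (r * t) = c t * \<psi> (r * t)" "c t \<ge> 0" if "0 < t" "t < 1" for t
    using rt[OF that] reduced_kernel_factor[of x "r * t"] assms by (auto simp: c_def \<psi>_def)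
  show ?thesis
  proof (cases "\<exists>t. 0 < t \<and> t < 1 \<and> \<psi> (r * t) < 0")
    case False
    then show ?thesis using f by (intro that(2)) (metis mult_nonneg_nonneg not_less)
  next
    case True
    then obtain t1 where t1: "0 < t1" "t1 < 1" "\<psi> (r * t1) < 0" by blast
    have "r \<noteq> 0" using t1 by (auto simp: \<psi>_def)
    then have r: "r > 0" using assms by simp
    have "continuous_on {0..t1} (\<lambda>t. \<psi> (r * t))" unfolding \<psi>_def by (intro continuous_intros)
    then obtain t0 where t0: "0 \<le> t0" "t0 \<le> t1" "\<psi> (r * t0) = 0"
      using IVT2'[of "\<lambda>t. \<psi> (r * t)" t1 0 0] t1 by (force simp: \<psi>_def)
    have "t0 \<noteq> 0" using t0 by (auto simp: \<psi>_def)
    then have t0p: "t0 > 0" using t0 by simp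
    have mon: "(r * a) * \<psi> (r * b) \<le> (r * b) * \<psi> (r * a)" if "0 < a" "a \<le> b" "b < 1" for a b
      using crossing_poly_ratio_antimono[of x "r * a" "r * b"] that assms r rt[of b] unfolding \<psi>_def
      by (auto simp: less_imp_le)
    show ?thesis
    proof (rule that(1)[of t0])
      show "0 < t0" "t0 < 1" using t0p t0 t1 by auto
      fix t assume t: "t0 \<le> t" "t < 1"
      have "(r * t0) * \<psi> (r * t) \<le> 0" using mon[of t0 t] t t0 t0p by simp
      then have "\<psi> (r * t) \<le> 0" using r t0p by (simp add: mult_le_0_iff zero_less_mult_iff)
      then show "reduced_kernel x (r * t) \<le> 0"
        using f[of t] t t0p by (simp add: mult_nonneg_nonpos)
    next
      fix t assume t: "0 < t" "t \<le> t0"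
      have "0 \<le> \<psi> (r * t)"
      proof (rule ccontr)
        assume neg: "\<not> 0 \<le> \<psi> (r * t)"
        have "(r * t) * \<psi> (r * t0) \<le> (r * t0) * \<psi> (r * t)"
          using mon[of t t0] t t0 t1 by simp
        moreover have "(r * t0) * \<psi> (r * t) < 0" using neg r t0p by (simp add: mult_pos_neg)
        ultimately show False using t0 by simp
      qed
      then show "0 \<le> reduced_kernel x (r * t)" using f[of t] t t0 t1 by simp
    qed
  qed
qed

lemma tendsto_mult_ln_recip: "((\<lambda>t::real. t * ln (1 / t)) \<longlongrightarrow> 0) (at_right 0)"
  by real_asymp

lemma continuous_on_mult_ln_recip: "continuous_on {0..1} (\<lambda>t::real. t * ln (1 / t))"
proof (rule continuous_on_IccI)
  show "((\<lambda>t::real. t * ln (1 / t)) \<longlongrightarrow> 0 * ln (1 / 0)) (at_right 0)"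
    using tendsto_mult_ln_recip by simp
  show "((\<lambda>t::real. t * ln (1 / t)) \<longlongrightarrow> 1 * ln (1 / 1)) (at_left 1)"
    by (rule tendsto_eq_intros | simp)+
  fix x :: real assume "0 < x" "x < 1"
  then show "(\<lambda>t. t * ln (1 / t)) \<midarrow>x\<rightarrow> x * ln (1 / x)"
    by (intro tendsto_intros) auto
qed simp

text \<open>Let \<open>D\<close> be the quadratic in the denominator of the reduced kernel \<open>\<phi>\<close>. The singular part
  \<open>s (1-s)\<^sup>2/D\<^sup>2\<close> of \<open>2 \<phi>(s)\<close> is \<open>s (1-s)/(1+s)\<close> times the derivative of \<open>s/D\<close>. Integrating that part by
  parts, with \<open>M(t) = log(1/t) (rt)\<^sup>2 (1-rt) / ((1+rt) D(rt))\<close>, gives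
  \<open>2 r log(1/t) \<phi>(rt) = M'(t) + P(t)\<close> where \<open>P\<close> is \<open>r s/D\<close> times
  \<open>(1-s)/(1+s) - 2 s log(1/t)/(1+s)\<^sup>2\<close> at \<open>s = rt\<close>. As \<open>s \<le> t\<close>, the bound
  \<open>2 s log(1/s) \<le> 1 - s\<^sup>2\<close> makes \<open>P\<close> non-negative, and \<open>M\<close> vanishes at \<open>0\<close> and at \<open>1\<close>.\<close>

lemma integral_ln_recip_reduced_kernel_nonneg:
  assumes x: "\<bar>x\<bar> \<le> 1" and r: "0 \<le> r" "r < 1"
  shows "continuous_on {0..1} (\<lambda>t. ln (1 / t) * reduced_kernel x (r * t))"
    and "0 \<le> integral {0..1} (\<lambda>t. ln (1 / t) * reduced_kernel x (r * t))"
proof -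
  define L where "L = (\<lambda>t::real. ln (1 / t))"
  define D where "D = (\<lambda>s. 1 - 2 * s * x + s\<^sup>2)"
  define M where "M = (\<lambda>t. L t * ((r * t)\<^sup>2 * (1 - r * t) / ((1 + r * t) * D (r * t))))"
  define P where "P = (\<lambda>t. r * (r * t) / D (r * t) * ((1 - r * t) / (1 + r * t) - 2 * (r * t) * L t / (1 + r * t)\<^sup>2))"
  have rt: "0 \<le> r * t" "r * t < 1" "r * t \<le> t" if "0 \<le> t" "t \<le> 1" for t
  proof -
    show "0 \<le> r * t" using r that by simp
    have "r * t \<le> r * 1" using r that by (intro mult_left_mono) auto
    then show "r * t < 1" using r by simp
    show "r * t \<le> t" using r that by (simp add: mult_left_le_one_le)
  qed
  have D0: "D (r * t) \<noteq> 0" "D (r * t) > 0" if "0 \<le> t" "t \<le> 1" for t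
    using quad_pos[OF x rt(1,2)[OF that]] unfolding D_def by auto
  have p0: "1 + r * t \<noteq> 0" "0 < 1 + r * t" if "0 \<le> t" "t \<le> 1" for t using rt[OF that] by auto
  have cD: "continuous_on {0..1} (\<lambda>t. D (r * t))" unfolding D_def by (intro continuous_intros)
  have cL: "continuous_on {0..1} (\<lambda>t. t * L t)" unfolding L_def by (rule continuous_on_mult_ln_recip)
  have "continuous_on {0..1} (\<lambda>t. (t * L t) * (r * ((1 - r * t) / (D (r * t) * (1 + r * t)\<^sup>2) - r * t * (1 - x) / (D (r * t))\<^sup>2)))"
    using D0 p0 by (intro continuous_intros cD cL) auto
  then show c: "continuous_on {0..1} (\<lambda>t. ln (1 / t) * reduced_kernel x (r * t))"
    by (simp add: reduced_kernel_def D_def L_def mult_ac)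
  have "continuous_on {0..1} (\<lambda>t. (t * L t) * (r * (r * t) * (1 - r * t) / ((1 + r * t) * D (r * t))))"
    using D0 p0 by (intro continuous_intros cD cL) auto
  moreover have "(t * L t) * (r * (r * t) * (1 - r * t) / ((1 + r * t) * D (r * t))) = M t" for t
    by (simp add: M_def power2_eq_square)
  ultimately have cM: "continuous_on {0..1} M" by simp
  have dM: "(M has_vector_derivative (2 * r * (L t * reduced_kernel x (r * t)) - P t)) (at t)" if t: "t \<in> {0<..<1}" for t
  proof (cases "r = 0")
    case True
    then show ?thesis by (simp add: M_def P_def)
  next
    case False
    define s where "s = r * t"
    have s: "0 < s" "s < 1" using t r False rt[of t] by (auto simp: s_def)
    have Ds: "D s > 0" and p: "1 + s > 0" using D0[of t] p0[of t] t by (auto simp: s_def)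
    define N where "N = (\<lambda>s. s\<^sup>2 * (1 - s) / ((1 + s) * D s))"
    \<comment> \<open>The derivative of \<open>N\<close>, with the reciprocal square of \<open>D\<close> in the form in which it occurs in the reduced kernel.\<close>
    define N' where "N' = s * (1 - s)\<^sup>2 / (D s)\<^sup>2 + (1 - 2 * s - s\<^sup>2) * s / ((1 + s)\<^sup>2 * D s)"
    have "(N has_real_derivative ((2 * s - 3 * s\<^sup>2) * ((1 + s) * D s) - s\<^sup>2 * (1 - s) * (D s + (1 + s) * (2 * s - 2 * x))) / ((1 + s) * D s)\<^sup>2) (at s)"
      unfolding N_def
    proof (rule DERIV_cong[OF DERIV_divide])
      show dD: "((\<lambda>s. (1 + s) * D s) has_real_derivative D s + (1 + s) * (2 * s - 2 * x)) (at s)"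
        unfolding D_def by (auto intro!: derivative_eq_intros)
      show "((\<lambda>s. s\<^sup>2 * (1 - s)) has_real_derivative 2 * s - 3 * s\<^sup>2) (at s)"
        by (auto intro!: derivative_eq_intros simp: power2_eq_square algebra_simps)
    qed (use Ds p in \<open>auto simp: power2_eq_square\<close>)
    moreover have "((2 * s - 3 * s\<^sup>2) * ((1 + s) * D s) - s\<^sup>2 * (1 - s) * (D s + (1 + s) * (2 * s - 2 * x))) / ((1 + s) * D s)\<^sup>2 = N'"
    proof -
      have x': "2 * s * x = 1 + s\<^sup>2 - D s" by (simp add: D_def)
      have "(2 * s - 3 * s\<^sup>2) * ((1 + s) * D s) - s\<^sup>2 * (1 - s) * (D s + (1 + s) * (2 * s - 2 * x))
        = (2 * s - 3 * s\<^sup>2) * ((1 + s) * D s) - s\<^sup>2 * (1 - s) * D s - s * (1 - s) * (1 + s) * (2 * s\<^sup>2 - 2 * s * x)"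
        by (simp add: power2_eq_square algebra_simps)
      also have "\<dots> = s * (1 - s)\<^sup>2 * (1 + s)\<^sup>2 + (1 - 2 * s - s\<^sup>2) * s * D s"
        unfolding x' by (simp add: power2_eq_square algebra_simps)
      finally have e: "(2 * s - 3 * s\<^sup>2) * ((1 + s) * D s) - s\<^sup>2 * (1 - s) * (D s + (1 + s) * (2 * s - 2 * x))
        = s * (1 - s)\<^sup>2 * (1 + s)\<^sup>2 + (1 - 2 * s - s\<^sup>2) * s * D s" .
      show ?thesis unfolding e N'_def using Ds p
        by (simp add: power_mult_distrib add_divide_distrib) (simp add: power2_eq_square)
    qed
    ultimately have dN: "(N has_real_derivative N') (at (r * t))" by (simp add: s_def)
    have "((\<lambda>t. N (r * t)) has_real_derivative N' * r) (at t)"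
      by (rule DERIV_chain2[where f = N and g = "\<lambda>t. r * t", OF dN]) (auto intro!: derivative_eq_intros)
    moreover have "(L has_real_derivative (- 1 / t)) (at t)"
      unfolding L_def using t by (auto intro!: derivative_eq_intros simp: power2_eq_square)
    ultimately have dLN: "((\<lambda>t. L t * N (r * t)) has_real_derivative (- 1 / t * N (r * t) + N' * r * L t)) (at t)"
      by (intro DERIV_mult)
    have "1 / t * N (r * t) = r * s / D s * ((1 - s) / (1 + s))"
      using t r False Ds p unfolding s_def[symmetric] N_def
      by (simp add: s_def power2_eq_square mult_ac)
    then have "- 1 / t * N (r * t) = - (r * s / D s * ((1 - s) / (1 + s)))" by simp
    moreover have "N' = 2 * reduced_kernel x s + s / D s * (2 * s / (1 + s)\<^sup>2)"
    proof -
      have y: "2 * s * (1 - x) = D s - (1 - s)\<^sup>2" by (simp add: D_def power2_eq_square algebra_simps)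
      have "2 * reduced_kernel x s = s * (2 * (1 - s) / (D s * (1 + s)\<^sup>2) - 2 * s * (1 - x) / (D s)\<^sup>2)"
        by (simp add: reduced_kernel_def D_def algebra_simps)
      also have "\<dots> = s * (2 * (1 - s) / (D s * (1 + s)\<^sup>2) - 1 / D s + (1 - s)\<^sup>2 / (D s)\<^sup>2)"
        unfolding y using Ds by (simp add: diff_divide_distrib power2_eq_square)
      finally have k: "2 * reduced_kernel x s = s * (2 * (1 - s) / (D s * (1 + s)\<^sup>2) - 1 / D s) + s * (1 - s)\<^sup>2 / (D s)\<^sup>2"
        by (simp add: algebra_simps)
      have "(1 - 2 * s - s\<^sup>2) * s / ((1 + s)\<^sup>2 * D s) = s * (2 * (1 - s) / (D s * (1 + s)\<^sup>2) - 1 / D s) + s / D s * (2 * s / (1 + s)\<^sup>2)"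
        using Ds p by (simp add: divide_simps) (simp add: power2_eq_square algebra_simps)
      then show ?thesis unfolding k N'_def by simp
    qed
    moreover have "P t = r * s / D s * ((1 - s) / (1 + s)) - r * s / D s * (2 * s * L t / (1 + s)\<^sup>2)"
      by (simp add: P_def s_def right_diff_distrib)
    ultimately have "- 1 / t * N (r * t) + N' * r * L t = 2 * r * (L t * reduced_kernel x (r * t)) - P t"
      by (simp add: s_def[symmetric] algebra_simps)
    moreover have "M = (\<lambda>t. L t * N (r * t))" by (simp add: M_def N_def)
    ultimately have "(M has_real_derivative (2 * r * (L t * reduced_kernel x (r * t)) - P t)) (at t)"
      using dLN by simp
    then show ?thesis by (simp add: has_real_derivative_iff_has_vector_derivative)
  qed
  have "((\<lambda>t. 2 * r * (L t * reduced_kernel x (r * t)) - P t) has_integral (M 1 - M 0)) {0..1}"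
    by (rule fundamental_theorem_of_calculus_interior[OF _ cM dM]) auto
  then have i1: "((\<lambda>t. 2 * r * (L t * reduced_kernel x (r * t)) - P t) has_integral 0) {0..1}"
    by (simp add: M_def L_def)
  have i2: "((\<lambda>t. L t * reduced_kernel x (r * t)) has_integral (integral {0..1} (\<lambda>t. L t * reduced_kernel x (r * t)))) {0..1}"
    using c unfolding L_def by (intro integrable_integral integrable_continuous_real)
  have "0 \<le> 2 * r * integral {0..1} (\<lambda>t. L t * reduced_kernel x (r * t))"
  proof -
    have "0 \<le> 2 * r * integral {0..1} (\<lambda>t. L t * reduced_kernel x (r * t)) - 0"
    proof (rule has_integral_nonneg[OF has_integral_diff[OF has_integral_mult_right[OF i2, of "2 * r"] i1]])
      fix t :: real assume t: "t \<in> {0..1}"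
      have "2 * (r * t) * L t \<le> 1 - (r * t)\<^sup>2"
      proof (cases "r * t = 0")
        case False
        then have pos: "0 < r * t" using rt(1)[of t] t by (metis atLeastAtMost_iff less_eq_real_def)
        then have tp: "0 < t" using r t by (auto simp: zero_less_mult_iff)
        have "L t \<le> ln (1 / (r * t))" unfolding L_def
          using pos tp rt(3)[of t] t by (subst ln_le_cancel_iff) (auto intro!: divide_left_mono simp: zero_less_mult_iff)
        then have "2 * (r * t) * L t \<le> 2 * (r * t) * ln (1 / (r * t))" using pos by (intro mult_left_mono) auto
        also have "\<dots> \<le> 1 - (r * t)\<^sup>2" using ln_recip_le[OF pos] rt[of t] t by simp
        finally show ?thesis .
      qed auto
      then have "2 * (r * t) * L t / (1 + r * t)\<^sup>2 \<le> (1 - (r * t)\<^sup>2) / (1 + r * t)\<^sup>2"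
        by (intro divide_right_mono) auto
      also have "\<dots> = (1 - r * t) / (1 + r * t)" using p0[of t] t
        by (simp add: divide_simps) (simp add: power2_eq_square algebra_simps)
      finally have "0 \<le> P t" unfolding P_def using rt[of t] D0[of t] t r by (intro mult_nonneg_nonneg divide_nonneg_nonneg) auto
      then show "0 \<le> 2 * r * (L t * reduced_kernel x (r * t)) - (2 * r * (L t * reduced_kernel x (r * t)) - P t)" by simp
    qed
    then show ?thesis by simp
  qed
  then show "0 \<le> integral {0..1} (\<lambda>t. ln (1 / t) * reduced_kernel x (r * t))"
  proof (cases "r = 0")
    case True then show ?thesis by (simp add: reduced_kernel_def)
  next
    case False
    with r \<open>0 \<le> 2 * r * _\<close> show ?thesis by (simp add: L_def zero_le_mult_iff)
  qed
qed

lemma starlike_bound_continuous: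
  assumes "\<sigma> < 1" shows "continuous_on {0..1} (starlike_bound \<sigma>)"
  unfolding starlike_bound_def using assms
  by (intro continuous_intros) auto

lemma starlike_kernel_continuous:
  assumes "norm z < 1" "\<sigma> < 1" shows "continuous_on {0..1} (\<lambda>t. starlike_kernel \<sigma> \<epsilon> (of_real t * z))"
proof -
  have "of_real t * z \<noteq> 1" if "t \<in> {0..1}" for t
  proof
    assume "of_real t * z = 1"
    then have "\<bar>t\<bar> * norm z = 1" by (metis norm_mult norm_of_real norm_one)
    moreover have "\<bar>t\<bar> * norm z \<le> 1 * norm z" using that by (intro mult_right_mono) auto
    ultimately show False using assms by simp
  qed
  then show ?thesis unfolding starlike_kernel_def using assms
    by (intro continuous_intros) (auto simp flip: of_real_eq_iff)
qed

text \<open>If \<open>t\<^sub>0\<close> is the sign change of the reduced kernel \<open>\<phi>\<close>, then \<open>k \<phi> \<ge> k(t\<^sub>0) \<phi>\<close> on both sides of it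
  because \<open>k\<close> is non-increasing; where \<open>\<phi>\<close> is non-negative throughout, \<open>k \<phi> \<ge> 0\<close>. In both cases the
  integral reduces to the one against \<open>log(1/t)\<close>. The modulus \<open>r = |z|\<close> costs nothing: the lower bound holds with
  \<open>starlike_bound \<sigma> (r t)\<close>, which is at least \<open>starlike_bound \<sigma> t\<close>.\<close>

lemma integral_starlike_kernel_ge:
  assumes \<sigma>: "0 \<le> \<sigma>" "\<sigma> \<le> 1/2" and z: "norm z < 1" and \<epsilon>: "norm \<epsilon> = 1"
    and W: "set_integrable lebesgue {0..1} W"
    and Wk: "\<And>t. 0 < t \<Longrightarrow> t < 1 \<Longrightarrow> W t = k t * ln (1 / t)"
    and k0: "\<And>t. 0 < t \<Longrightarrow> t < 1 \<Longrightarrow> 0 \<le> k t"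
    and k: "\<And>s t. 0 < s \<Longrightarrow> s \<le> t \<Longrightarrow> t < 1 \<Longrightarrow> k t \<le> k s"
  shows "(LINT t:{0..1}|lebesgue. W t * starlike_bound \<sigma> t)
    \<le> (LINT t:{0..1}|lebesgue. W t * Re (starlike_kernel \<sigma> \<epsilon> (of_real t * z)))"
proof -
  define r where "r = norm z"
  have r: "0 \<le> r" "r < 1" using z by (auto simp: r_def)
  obtain \<zeta> where \<zeta>: "norm \<zeta> = 1" "z = of_real r * \<zeta>"
  proof (cases "z = 0")
    case True then show ?thesis using that[of 1] by (simp add: r_def)
  next
    case False
    show ?thesis
    proof (rule that)
      show "norm (sgn z) = 1" using False by (simp add: norm_sgn)
      show "z = of_real r * sgn z" using False by (simp add: r_def sgn_div_norm scaleR_conv_of_real)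
    qed
  qed
  define x where "x = Re \<zeta>"
  have x: "\<bar>x\<bar> \<le> 1" using \<zeta>(1) abs_Re_le_cmod[of \<zeta>] by (simp add: x_def)
  define c where "c = 2 * (1 + x) / (2 - 2 * \<sigma>)"
  have c: "c \<ge> 0" using x \<sigma> by (simp add: c_def)
  define \<phi> where "\<phi> = (\<lambda>t. reduced_kernel x (r * t))"
  obtain m where m: "0 \<le> m" "\<And>t. 0 < t \<Longrightarrow> t < 1 \<Longrightarrow> m * \<phi> t \<le> k t * \<phi> t"
    using x r
  proof (cases rule: reduced_kernel_crossing)
    case (1 t0)
    show ?thesis
    proof (rule that[of "k t0"])
      fix t :: real assume t: "0 < t" "t < 1"
      show "k t0 * \<phi> t \<le> k t * \<phi> t"
      proof (cases "t \<le> t0")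
        case True
        then show ?thesis using 1 t k[of t t0] by (intro mult_right_mono) (auto simp: \<phi>_def)
      next
        case False
        then show ?thesis using 1 t k[of t0 t] by (intro mult_right_mono_neg) (auto simp: \<phi>_def)
      qed
    qed (use 1 k0 in auto)
  next
    case 2
    show ?thesis by (rule that[of 0]) (use 2 k0 in \<open>auto simp: \<phi>_def\<close>)
  qed
  note J = integral_ln_recip_reduced_kernel_nonneg[OF x r]
  have iJ: "set_integrable lebesgue {0..1} (\<lambda>t. (c * m) * (ln (1 / t) * \<phi> t))"
    using absolutely_integrable_continuous_real[OF J(1)] unfolding \<phi>_def by (rule set_integrable_mult_right)
  define R where "R = (\<lambda>t. Re (starlike_kernel \<sigma> \<epsilon> (of_real t * z)))"
  have iH: "set_integrable lebesgue {0..1} (\<lambda>t. W t * R t)"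
    using set_integrable_mult_continuous[OF W, of R] starlike_kernel_continuous[OF z] \<sigma>
    by (simp add: R_def continuous_intros)
  have iB: "set_integrable lebesgue {0..1} (\<lambda>t. W t * starlike_bound \<sigma> t)"
    using set_integrable_mult_continuous[OF W starlike_bound_continuous] \<sigma> by simp
  have "0 \<le> (c * m) * integral {0..1} (\<lambda>t. ln (1 / t) * \<phi> t)"
    using J(2) c m unfolding \<phi>_def by simp
  also have "\<dots> = (c * m) * (LINT t:{0..1}|lebesgue. ln (1 / t) * \<phi> t)"
    using set_lebesgue_integral_eq_integral(2)[OF absolutely_integrable_continuous_real[OF J(1)]] by (simp add: \<phi>_def)
  also have "\<dots> = (LINT t:{0..1}|lebesgue. (c * m) * (ln (1 / t) * \<phi> t))" by simp
  also have "\<dots> \<le> (LINT t:{0..1}|lebesgue. W t * R t - W t * starlike_bound \<sigma> t)"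
  proof (rule set_integral_mono_AE[OF iJ])
    show "set_integrable lebesgue {0..1} (\<lambda>t. W t * R t - W t * starlike_bound \<sigma> t)"
      using iH iB by (rule set_integral_diff)
    show "AE t\<in>{0..1} in lebesgue. (c * m) * (ln (1 / t) * \<phi> t) \<le> W t * R t - W t * starlike_bound \<sigma> t"
      using AE_lebesgue_neq_0_1
    proof eventually_elim
      case (elim t)
      show ?case
      proof
        assume "t \<in> {0..1}"
        with elim have t: "0 < t" "t < 1" by auto
        have rt: "0 \<le> r * t" "r * t \<le> t" "r * t < 1" using r t
          by (auto simp: mult_left_le_one_le intro: order.strict_trans1[OF mult_left_le_one_le])
        have eq: "of_real t * z = of_real (r * t) * \<zeta>" using \<zeta> by simp
        have "c * \<phi> t \<le> R t - starlike_bound \<sigma> (r * t)"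
          using reduced_kernel_lower_bound[OF \<sigma> rt(1,3) \<zeta>(1) \<epsilon>]
          by (simp only: eq c_def \<phi>_def R_def x_def times_divide_eq_left)
        also have "\<dots> \<le> R t - starlike_bound \<sigma> t"
          using starlike_bound_antimono[OF \<sigma> rt(1,2)] t by simp
        finally have p: "c * \<phi> t \<le> R t - starlike_bound \<sigma> t" .
        have l: "0 \<le> ln (1 / t)" using t by simp
        have "(c * m) * (ln (1 / t) * \<phi> t) = (c * ln (1 / t)) * (m * \<phi> t)" by simp
        also have "\<dots> \<le> (c * ln (1 / t)) * (k t * \<phi> t)"
          using m(2)[OF t] c l by (intro mult_left_mono mult_nonneg_nonneg) auto
        also have "\<dots> = W t * (c * \<phi> t)" using Wk[OF t] by simp
        also have "\<dots> \<le> W t * (R t - starlike_bound \<sigma> t)"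
          using p Wk[OF t] k0[OF t] l by (intro mult_left_mono) auto
        finally show "(c * m) * (ln (1 / t) * \<phi> t) \<le> W t * R t - W t * starlike_bound \<sigma> t"
          by (simp add: algebra_simps)
      qed
    qed
  qed
  also have "\<dots> = (LINT t:{0..1}|lebesgue. W t * R t) - (LINT t:{0..1}|lebesgue. W t * starlike_bound \<sigma> t)"
    using iH iB by (rule set_integral_diff)
  finally show ?thesis by (simp add: R_def)
qed

section \<open>Iterated tail integrals and power averages\<close>

text \<open>\<open>Lambda_fun\<close> is such a tail integral of \<open>lam\<close>, and \<open>Pi_fun\<close> one of \<open>Lambda_fun\<close> times a power.\<close>

definition tail_integral :: "real \<Rightarrow> (real \<Rightarrow> real) \<Rightarrow> real \<Rightarrow> real" where
  "tail_integral a f t = (LINT x:{t..1}|lebesgue. f x / x powr a)"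

text \<open>The adjoint of \<open>f \<mapsto> tail_integral a f t * t powr (a - 1)\<close>. On the monomial of degree \<open>m\<close> it acts as
  the factor \<open>1 / (a + m)\<close>, and the inner and outer integrals of \<open>g_fun\<close> and \<open>q_fun\<close> have this form.\<close>

definition power_average :: "real \<Rightarrow> (real \<Rightarrow> real) \<Rightarrow> real \<Rightarrow> real" where
  "power_average a \<psi> x = (LINT w:{0..1}|lebesgue. w powr (a - 1) * \<psi> (x * w))"

lemma sigma_finite_lebesgue: "sigma_finite_measure (lebesgue :: real measure)"
proof
  obtain A :: "real set set" where A: "countable A" "A \<subseteq> sets lborel" "\<Union>A = space lborel" "\<forall>a\<in>A. emeasure lborel a \<noteq> \<infinity>"
    using lborel.sigma_finite_countable by blast
  show "\<exists>A. countable A \<and> A \<subseteq> sets (lebesgue :: real measure) \<and> \<Union>A = space lebesgue \<and> (\<forall>a\<in>A. emeasure lebesgue a \<noteq> \<infinity>)"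
    using A by (intro exI[of _ A]) (auto simp: emeasure_completion)
qed

lemma powr_integrable_unit:
  assumes "0 < (a::real)"
  shows "set_integrable lebesgue {0..1} (\<lambda>w. w powr (a - 1))"
    and "0 \<le> c \<Longrightarrow> set_integrable lebesgue {0..c} (\<lambda>w. w powr (a - 1))"
    and "0 \<le> c \<Longrightarrow> (LINT w:{0..c}|lebesgue. w powr (a - 1)) = c powr a / a"
proof -
  have i: "((\<lambda>w. w powr (a - 1)) has_integral (c powr a / a)) {0..c}" if "0 \<le> c" for c
    using has_integral_powr_from_0[of "a - 1" c] assms that by simp
  have s: "set_integrable lebesgue {0..c} (\<lambda>w. w powr (a - 1))" if "0 \<le> c" for c
    using i[OF that] by (intro nonnegative_absolutely_integrable_1) auto
  show "set_integrable lebesgue {0..1} (\<lambda>w. w powr (a - 1))" by (rule s) simp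
  show "0 \<le> c \<Longrightarrow> set_integrable lebesgue {0..c} (\<lambda>w. w powr (a - 1))" by (rule s)
  show "0 \<le> c \<Longrightarrow> (LINT w:{0..c}|lebesgue. w powr (a - 1)) = c powr a / a"
    using i s by (simp add: set_lebesgue_integral_eq_integral integral_unique)
qed

lemma unit_interval_mult: "x \<in> {0..1} \<Longrightarrow> w \<in> {0..1} \<Longrightarrow> x * w \<in> {0..1::real}"
  by (simp add: mult_le_one)

lemma power_average_integrable:
  fixes \<psi> :: "real \<Rightarrow> real"
  assumes "0 < a" "continuous_on {0..1} \<psi>" "x \<in> {0..1}"
  shows "set_integrable lebesgue {0..1} (\<lambda>w. w powr (a - 1) * \<psi> (x * w))"
proof -
  have "continuous_on {0..1} (\<lambda>w. \<psi> (x * w))"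
    by (intro continuous_on_compose2[OF assms(2)] continuous_intros image_subsetI unit_interval_mult[OF assms(3)])
  from set_integrable_mult_continuous[OF powr_integrable_unit(1)[OF assms(1)] this] show ?thesis by simp
qed

lemma power_average_continuous:
  assumes "0 < a" "continuous_on {0..1} \<psi>"
  shows "continuous_on {0..1} (power_average a \<psi>)"
  unfolding continuous_on_sequentially comp_def
proof (intro allI ballI impI, elim conjE)
  fix x and p :: real
  assume p: "p \<in> {0..1}" and x: "\<forall>n. x n \<in> {0..1}" and lim: "x \<longlonglongrightarrow> p"
  have "bounded (\<psi> ` {0..1})" using assms by (intro compact_imp_bounded compact_continuous_image) auto
  then obtain C where "\<forall>t\<in>{0..1}. \<bar>\<psi> t\<bar> \<le> C" by (auto simp: bounded_iff)
  then have C: "\<bar>\<psi> t\<bar> \<le> C" if "t \<in> {0..1}" for t using that by blast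
  have "(\<lambda>n. LINT w|lebesgue. indicator {0..1} w *\<^sub>R (w powr (a - 1) * \<psi> (x n * w)))
     \<longlonglongrightarrow> (LINT w|lebesgue. indicator {0..1} w *\<^sub>R (w powr (a - 1) * \<psi> (p * w)))"
  proof (rule integral_dominated_convergence)
    show "integrable lebesgue (\<lambda>w. indicator {0..1} w *\<^sub>R (C * w powr (a - 1)))"
      using powr_integrable_unit(1)[OF assms(1), THEN set_integrable_mult_right, of C] by (simp add: set_integrable_def)
    show "(\<lambda>w. indicator {0..1} w *\<^sub>R (w powr (a - 1) * \<psi> (p * w))) \<in> borel_measurable lebesgue"
      using power_average_integrable[OF assms p] unfolding set_integrable_def by (rule borel_measurable_integrable)
    show "(\<lambda>w. indicator {0..1} w *\<^sub>R (w powr (a - 1) * \<psi> (x n * w))) \<in> borel_measurable lebesgue" for n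
      using power_average_integrable[OF assms, of "x n"] x unfolding set_integrable_def by (auto intro: borel_measurable_integrable)
    show "AE w in lebesgue. (\<lambda>n. indicator {0..1} w *\<^sub>R (w powr (a - 1) * \<psi> (x n * w)))
       \<longlonglongrightarrow> indicator {0..1} w *\<^sub>R (w powr (a - 1) * \<psi> (p * w))"
    proof (rule AE_I2)
      fix w :: real
      show "(\<lambda>n. indicator {0..1} w *\<^sub>R (w powr (a - 1) * \<psi> (x n * w)))
       \<longlonglongrightarrow> indicator {0..1} w *\<^sub>R (w powr (a - 1) * \<psi> (p * w))"
      proof (cases "w \<in> {0..1}")
        case True
        have "(\<lambda>n. \<psi> (x n * w)) \<longlonglongrightarrow> \<psi> (p * w)"
          using True p x unit_interval_mult
          by (intro continuous_on_tendsto_compose[OF assms(2)] tendsto_intros lim always_eventually allI) blast+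
        then show ?thesis by (intro tendsto_intros)
      qed simp
    qed
    show "AE w in lebesgue. norm (indicator {0..1} w *\<^sub>R (w powr (a - 1) * \<psi> (x n * w))) \<le> indicator {0..1} w *\<^sub>R (C * w powr (a - 1))" for n
    proof (rule AE_I2)
      fix w :: real
      show "norm (indicator {0..1} w *\<^sub>R (w powr (a - 1) * \<psi> (x n * w))) \<le> indicator {0..1} w *\<^sub>R (C * w powr (a - 1))"
      proof (cases "w \<in> {0..1}")
        case True
        then have "\<bar>\<psi> (x n * w)\<bar> \<le> C" using x unit_interval_mult by (intro C) blast
        then have "w powr (a - 1) * \<bar>\<psi> (x n * w)\<bar> \<le> w powr (a - 1) * C" by (intro mult_left_mono) auto
        then show ?thesis using True by (simp add: abs_mult mult.commute)
      qed simp
    qed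
  qed
  then show "(\<lambda>n. power_average a \<psi> (x n)) \<longlonglongrightarrow> power_average a \<psi> p"
    by (simp add: power_average_def set_lebesgue_integral_def)
qed

text \<open>Exchange the order of integration over the triangle \<open>0 \<le> t \<le> x \<le> 1\<close> and substitute \<open>t = x w\<close> in
  the inner integral. Absolute integrability comes from the majorant \<open>G\<close>, in which \<open>\<psi>\<close> is
  replaced by a bound: its inner integral is a constant multiple of \<open>|f x|\<close>.\<close>

lemma tail_integral_fubini:
  assumes a: "0 < a" and f: "set_integrable lebesgue {0..1} f" and \<psi>: "continuous_on {0..1} \<psi>"
  shows "set_integrable lebesgue {0..1} (\<lambda>t. tail_integral a f t * t powr (a - 1) * \<psi> t)"
    and "(LINT t:{0..1}|lebesgue. tail_integral a f t * t powr (a - 1) * \<psi> t) =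
      (LINT x:{0..1}|lebesgue. f x * power_average a \<psi> x)"
proof -
  interpret pair_sigma_finite "lebesgue :: real measure" "lebesgue :: real measure"
    by (simp add: pair_sigma_finite_def sigma_finite_lebesgue)
  define f0 where "f0 = (\<lambda>x. indicator {0..1} x * f x)"
  define \<psi>0 where "\<psi>0 = (\<lambda>x. indicator {0..1} x * \<psi> x)"
  have f0: "integrable lebesgue f0" using f by (simp add: f0_def set_integrable_def)
  have \<psi>0: "\<psi>0 \<in> borel_measurable borel"
    using borel_measurable_continuous_on_indicator[OF _ \<psi>] by (simp add: \<psi>0_def)
  have "bounded (\<psi> ` {0..1})" using \<psi> by (intro compact_imp_bounded compact_continuous_image) auto
  then obtain C where "\<forall>t\<in>{0..1}. \<bar>\<psi> t\<bar> \<le> C" by (auto simp: bounded_iff)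
  then have C: "\<bar>\<psi> t\<bar> \<le> C" if "t \<in> {0..1}" for t using that by blast
  have C0: "0 \<le> C" using C[of 0] by simp
  have [measurable]: "f0 \<in> borel_measurable lebesgue" using f0 by simp
  have id[measurable]: "(\<lambda>x::real. x) \<in> borel_measurable lebesgue" by (intro measurable_completion) simp
  have [measurable]: "(\<lambda>p::real \<times> real. fst p) \<in> borel_measurable (lebesgue \<Otimes>\<^sub>M lebesgue)"
    "(\<lambda>p::real \<times> real. snd p) \<in> borel_measurable (lebesgue \<Otimes>\<^sub>M lebesgue)"
    by (auto intro: measurable_compose[OF measurable_fst id] measurable_compose[OF measurable_snd id])
  have [measurable]: "(\<lambda>p::real \<times> real. f0 (fst p)) \<in> borel_measurable (lebesgue \<Otimes>\<^sub>M lebesgue)"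
    by (rule measurable_compose[OF measurable_fst]) simp
  have [measurable]: "(\<lambda>p::real \<times> real. \<psi>0 (snd p)) \<in> borel_measurable (lebesgue \<Otimes>\<^sub>M lebesgue)"
    by (rule measurable_compose[OF _ \<psi>0]) simp
  define G where "G = (\<lambda>x t. \<bar>f0 x\<bar> * x powr (- a) * (indicator {0..x} t * t powr (a - 1) * C))"
  define F where "F = (\<lambda>x t. f0 x * x powr (- a) * (indicator {0..x} t * t powr (a - 1) * \<psi>0 t))"
  have ind: "(\<lambda>p::real \<times> real. indicator {0..fst p} (snd p) :: real) \<in> borel_measurable (lebesgue \<Otimes>\<^sub>M lebesgue)"
  proof -
    have "(\<lambda>p::real \<times> real. indicator {0..fst p} (snd p) :: real) = (\<lambda>p. if 0 \<le> snd p \<and> snd p \<le> fst p then 1 else 0)"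
      by (auto simp: indicator_def)
    then show ?thesis by simp
  qed
  have mG: "(\<lambda>p. G (fst p) (snd p)) \<in> borel_measurable (lebesgue \<Otimes>\<^sub>M lebesgue)"
    unfolding G_def by (intro borel_measurable_times ind) measurable
  have mF: "(\<lambda>p. F (fst p) (snd p)) \<in> borel_measurable (lebesgue \<Otimes>\<^sub>M lebesgue)"
    unfolding F_def by (intro borel_measurable_times ind) measurable
  have Gi: "integrable lebesgue (G x)" "(LINT t|lebesgue. G x t) = (if x = 0 then 0 else \<bar>f0 x\<bar> * (C / a))" for x
  proof -
    have *: "integrable lebesgue (G x) \<and> (LINT t|lebesgue. G x t) = (if x = 0 then 0 else \<bar>f0 x\<bar> * (C / a))"
    proof (cases "0 < x")
      case False
      then have "G x = (\<lambda>t. 0)" by (cases "x = 0") (auto simp: G_def f0_def fun_eq_iff)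
      then show ?thesis using False by (cases "x = 0") (auto simp: f0_def)
    next
      case True
      have e: "G x = (\<lambda>t. (\<bar>f0 x\<bar> * x powr (- a) * C) * (indicator {0..x} t *\<^sub>R t powr (a - 1)))"
        by (auto simp: G_def fun_eq_iff)
      show ?thesis unfolding e
        using powr_integrable_unit(2,3)[OF a, of x] True
        by (simp add: set_integrable_def set_lebesgue_integral_def powr_minus field_simps)
    qed
    then show "integrable lebesgue (G x)" "(LINT t|lebesgue. G x t) = (if x = 0 then 0 else \<bar>f0 x\<bar> * (C / a))" by auto
  qed
  have Gn: "0 \<le> G x t" for x t using C0 by (simp add: G_def)
  have iG: "integrable (lebesgue \<Otimes>\<^sub>M lebesgue) (\<lambda>p. G (fst p) (snd p))"
  proof (rule Fubini_integrable[OF mG])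
    have "integrable lebesgue (\<lambda>x. \<bar>f0 x\<bar> * (C / a))" using f0 by (intro integrable_mult_left integrable_abs)
    then have "integrable lebesgue (\<lambda>x. if x = 0 then 0 else \<bar>f0 x\<bar> * (C / a))"
      by (rule Bochner_Integration.integrable_bound) auto
    then show "integrable lebesgue (\<lambda>x. LINT t|lebesgue. norm (G (fst (x, t)) (snd (x, t))))"
      using Gi Gn by simp
    show "AE x in lebesgue. integrable lebesgue (\<lambda>t. G (fst (x, t)) (snd (x, t)))" using Gi by simp
  qed
  have FG: "\<bar>F x t\<bar> \<le> G x t" for x t
  proof -
    have "\<bar>\<psi>0 t\<bar> \<le> C" using C[of t] C0 by (cases "t \<in> {0..1}") (auto simp: \<psi>0_def)
    then show ?thesis unfolding F_def G_def abs_mult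
      by (intro mult_mono mult_nonneg_nonneg) auto
  qed
  have iF: "integrable (lebesgue \<Otimes>\<^sub>M lebesgue) (case_prod F)"
    using Bochner_Integration.integrable_bound[OF iG mF] FG Gn by (simp add: case_prod_beta' abs_of_nonneg)
  have inner_x: "(LINT x|lebesgue. F x t) = indicator {0..1} t *\<^sub>R (tail_integral a f t * t powr (a - 1) * \<psi> t)" for t
  proof -
    have "(LINT x|lebesgue. F x t) = (LINT x|lebesgue. (t powr (a - 1) * \<psi>0 t) * (indicator {t..1} x *\<^sub>R (f x / x powr a)))"
      by (intro Bochner_Integration.integral_cong) (auto simp: F_def f0_def \<psi>0_def indicator_def powr_minus divide_simps)
    also have "\<dots> = (t powr (a - 1) * \<psi>0 t) * tail_integral a f t"
      unfolding tail_integral_def set_lebesgue_integral_def by (rule integral_mult_right_zero)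
    finally show ?thesis by (simp add: \<psi>0_def)
  qed
  have inner_t: "(LINT t|lebesgue. F x t) = f0 x * power_average a \<psi> x" if "x \<noteq> 0" for x
  proof (cases "0 < x \<and> x \<le> 1")
    case False
    then show ?thesis using that by (auto simp: F_def f0_def)
  next
    case True
    define h where "h = (\<lambda>t. indicator {0..x} t * t powr (a - 1) * \<psi>0 t)"
    have h: "h \<in> borel_measurable borel" unfolding h_def using \<psi>0 by measurable
    have "(LINT t|lebesgue. h t) = (LINT t|lborel. h t)" using h by (intro integral_completion) simp
    also have "\<dots> = x * (LINT w|lborel. h (x * w))"
      using lborel_integral_real_affine[of x h 0] True by simp
    also have "(LINT w|lborel. h (x * w)) = (LINT w|lebesgue. h (x * w))"
      using h by (intro integral_completion[symmetric]) simp
    also have "(LINT w|lebesgue. h (x * w)) = (LINT w|lebesgue. x powr (a - 1) * (indicator {0..1} w *\<^sub>R (w powr (a - 1) * \<psi> (x * w))))"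
    proof (intro Bochner_Integration.integral_cong refl)
      fix w
      show "h (x * w) = x powr (a - 1) * (indicator {0..1} w *\<^sub>R (w powr (a - 1) * \<psi> (x * w)))"
      proof (cases "w \<in> {0..1}")
        case False
        then have "x * w \<notin> {0..x}" using True by (auto simp: zero_le_mult_iff)
        then show ?thesis using False by (simp add: h_def)
      next
        case w: True
        then have "x * w \<in> {0..x}" "x * w \<le> 1" using True by (auto simp: mult_le_one mult_left_le)
        then show ?thesis using w True by (simp add: h_def \<psi>0_def powr_mult)
      qed
    qed
    also have "\<dots> = x powr (a - 1) * power_average a \<psi> x"
      unfolding power_average_def set_lebesgue_integral_def by (rule integral_mult_right_zero)
    also have "x * \<dots> = x powr a * power_average a \<psi> x"
      using True by (simp add: powr_diff)
    finally have "(LINT t|lebesgue. h t) = x powr a * power_average a \<psi> x" .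
    then show ?thesis using True by (simp add: F_def h_def[symmetric] powr_minus)
  qed
  have pa: "set_integrable lebesgue {0..1} (\<lambda>x. f x * power_average a \<psi> x)"
    using set_integrable_mult_continuous[OF f power_average_continuous[OF a \<psi>]] by simp
  show "set_integrable lebesgue {0..1} (\<lambda>t. tail_integral a f t * t powr (a - 1) * \<psi> t)"
    using integrable_snd[OF iF] unfolding inner_x set_integrable_def .
  have "(LINT t:{0..1}|lebesgue. tail_integral a f t * t powr (a - 1) * \<psi> t) = (LINT t|lebesgue. LINT x|lebesgue. F x t)"
    unfolding inner_x set_lebesgue_integral_def ..
  also have "\<dots> = (LINT x|lebesgue. LINT t|lebesgue. F x t)"
    by (rule Fubini_integral[OF iF])
  also have "\<dots> = (LINT x|lebesgue. indicator {0..1} x *\<^sub>R (f x * power_average a \<psi> x))"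
  proof (rule integral_cong_AE)
    show "(\<lambda>x. LINT t|lebesgue. F x t) \<in> borel_measurable lebesgue"
      using integrable_fst[OF iF] by (rule borel_measurable_integrable)
    show "(\<lambda>x. indicator {0..1} x *\<^sub>R (f x * power_average a \<psi> x)) \<in> borel_measurable lebesgue"
      using pa unfolding set_integrable_def by (rule borel_measurable_integrable)
    show "AE x in lebesgue. (LINT t|lebesgue. F x t) = indicator {0..1} x *\<^sub>R (f x * power_average a \<psi> x)"
      using AE_lebesgue_neq_0_1 by eventually_elim (simp add: inner_t f0_def)
  qed
  finally show "(LINT t:{0..1}|lebesgue. tail_integral a f t * t powr (a - 1) * \<psi> t) =
      (LINT x:{0..1}|lebesgue. f x * power_average a \<psi> x)"
    by (simp add: set_lebesgue_integral_def)
qed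

lemma tail_integrand_integrable:
  fixes f :: "real \<Rightarrow> real"
  assumes "set_integrable lebesgue {0..1} f" "0 < c"
  shows "set_integrable lebesgue {c..1} (\<lambda>x. f x / x powr a)"
proof -
  have "set_integrable lebesgue {c..1} f"
    by (rule set_integrable_subset[OF assms(1)]) (use assms(2) in auto)
  moreover have "continuous_on {c..1} (\<lambda>x. 1 / x powr a)"
    using assms(2) by (intro continuous_intros) auto
  ultimately show ?thesis using set_integrable_mult_continuous[of c 1 f "\<lambda>x. 1 / x powr a"] by simp
qed

lemma tail_integral_continuous:
  assumes "set_integrable lebesgue {0..1} f" "0 < c"
  shows "continuous_on {c..1} (tail_integral a f)"
proof -
  note i = tail_integrand_integrable[OF assms]
  have "tail_integral a f t = integral {t..1} (\<lambda>x. f x / x powr a)" if "t \<in> {c..1}" for t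
    unfolding tail_integral_def using that
    by (intro set_lebesgue_integral_eq_integral(2) set_integrable_subset[OF i]) auto
  moreover have "continuous_on {c..1} (\<lambda>t. integral {t..1} (\<lambda>x. f x / x powr a))"
    by (rule indefinite_integral_continuous_1'[OF set_lebesgue_integral_eq_integral(1)[OF i]])
  ultimately show ?thesis by (metis (no_types, lifting) continuous_on_eq)
qed

lemma tail_integral_has_derivative:
  assumes f: "set_integrable lebesgue {0..1} f" and t: "0 < t" "t < 1"
    and cf: "\<And>c. 0 < c \<Longrightarrow> continuous_on {c..1} f"
  shows "(tail_integral a f has_real_derivative - (f t / t powr a)) (at t)"
proof -
  define c where "c = t / 2"
  have c: "0 < c" "c < t" using t by (auto simp: c_def)
  define h where "h = (\<lambda>x. f x / x powr a)"
  have ch: "continuous_on {c..1} h" unfolding h_def using c by (intro continuous_intros cf) auto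
  have i: "set_integrable lebesgue {c..1} h" unfolding h_def by (rule tail_integrand_integrable[OF f c(1)])
  have eq: "tail_integral a f s = integral {c..1} h - integral {c..s} h" if "s \<in> {c<..<1}" for s
  proof -
    have "tail_integral a f s = integral {s..1} h"
      unfolding tail_integral_def h_def[symmetric] using that
      by (intro set_lebesgue_integral_eq_integral(2) set_integrable_subset[OF i]) (auto simp: h_def)
    moreover have "integral {c..s} h + integral {s..1} h = integral {c..1} h"
      using that ch by (intro Henstock_Kurzweil_Integration.integral_combine integrable_continuous_real) auto
    ultimately show ?thesis by simp
  qed
  have "((\<lambda>s. integral {c..s} h) has_real_derivative h t) (at t within {c..1})"
    by (rule integral_has_real_derivative[OF ch]) (use c t in auto)
  then have "((\<lambda>s. integral {c..s} h) has_real_derivative h t) (at t)"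
    using c t by (subst (asm) at_within_interior) auto
  then have "((\<lambda>s. integral {c..1} h - integral {c..s} h) has_real_derivative - h t) (at t)"
    by (auto intro!: derivative_eq_intros)
  then have "(tail_integral a f has_real_derivative - h t) (at t)"
    by (rule has_field_derivative_transform_within_open[where S = "{c<..<1}"]) (use c t eq in auto)
  then show ?thesis by (simp add: h_def)
qed

lemma power_average_monomial:
  assumes "0 < a"
  shows "power_average a (\<lambda>t. t ^ m) x = x ^ m / (a + of_nat m)"
proof -
  have "w powr (a - 1) * (x * w) ^ m = x ^ m * w powr (a + real m - 1)" if "w \<in> {0..1}" for w
  proof (cases "w = 0")
    case False
    then have "w powr (a + real m - 1) = w powr (a - 1) * w ^ m" using that
      by (simp add: powr_realpow[symmetric] powr_add[symmetric] algebra_simps)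
    then show ?thesis by (simp add: power_mult_distrib)
  qed simp
  then have "power_average a (\<lambda>t. t ^ m) x = (LINT w:{0..1}|lebesgue. x ^ m * w powr (a + real m - 1))"
    unfolding power_average_def by (intro set_lebesgue_integral_cong) auto
  also have "\<dots> = x ^ m * (1 / (a + real m))"
    using powr_integrable_unit(3)[of "a + real m" 1] assms by simp
  finally show ?thesis by simp
qed

lemma power_average_cmult: "power_average a (\<lambda>t. c * \<psi> t) x = c * power_average a \<psi> x"
  unfolding power_average_def by (subst set_integral_mult_right[symmetric]) (simp add: mult_ac)

lemma power_average_add:
  assumes "0 < a" "continuous_on {0..1} \<psi>" "continuous_on {0..1} \<eta>" "x \<in> {0..1}"
  shows "power_average a (\<lambda>t. \<psi> t + \<eta> t) x = power_average a \<psi> x + power_average a \<eta> x"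
  unfolding power_average_def
  by (simp add: distrib_left set_integral_add power_average_integrable[OF assms(1,2,4)] power_average_integrable[OF assms(1,3,4)])

lemma power_average_cong:
  assumes "\<And>t. t \<in> {0..1} \<Longrightarrow> \<psi> t = \<eta> t" "x \<in> {0..1}"
  shows "power_average a \<psi> x = power_average a \<eta> x"
  unfolding power_average_def using assms unit_interval_mult
  by (intro set_lebesgue_integral_cong) auto

section \<open>The functions g and q as averages of the starlike bound\<close>

text \<open>The derivative of \<open>u \<mapsto> u * starlike_bound \<sigma> u\<close>, which is the integrand of \<open>q_fun\<close>.\<close>

definition starlike_bound_deriv :: "real \<Rightarrow> real \<Rightarrow> real" where
  "starlike_bound_deriv \<sigma> u = (1 - \<sigma> - (1 + \<sigma>) * u) / ((1 - \<sigma>) * (1 + u) ^ 3)"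

lemma starlike_bound_deriv_continuous:
  assumes "\<sigma> < 1" shows "continuous_on {0..1} (starlike_bound_deriv \<sigma>)"
  unfolding starlike_bound_deriv_def using assms by (intro continuous_intros) auto

text \<open>Integrate the derivative of \<open>s \<mapsto> s powr a * starlike_bound \<sigma> (x s)\<close> over \<open>[0,1]\<close>.\<close>

lemma power_average_by_parts:
  assumes a: "0 < a" and \<sigma>: "\<sigma> < 1" and x: "x \<in> {0..1}"
  shows "power_average a (starlike_bound_deriv \<sigma>) x = starlike_bound \<sigma> x + (1 - a) * power_average a (starlike_bound \<sigma>) x"
proof -
  define G where "G = (\<lambda>s. s powr a * starlike_bound \<sigma> (x * s))"
  define g where "g = (\<lambda>s. (a - 1) * (s powr (a - 1) * starlike_bound \<sigma> (x * s)) + s powr (a - 1) * starlike_bound_deriv \<sigma> (x * s))"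
  have i1: "set_integrable lebesgue {0..1} (\<lambda>s. (a - 1) * (s powr (a - 1) * starlike_bound \<sigma> (x * s)))"
    using power_average_integrable[OF a starlike_bound_continuous[OF \<sigma>] x] by (rule set_integrable_mult_right)
  note i2 = power_average_integrable[OF a starlike_bound_deriv_continuous[OF \<sigma>] x]
  have "(g has_integral (G 1 - G 0)) {0..1}"
  proof (rule fundamental_theorem_of_calculus_interior)
    have "continuous_on {0..1} (\<lambda>s. starlike_bound \<sigma> (x * s))"
      by (intro continuous_on_compose2[OF starlike_bound_continuous[OF \<sigma>]] continuous_intros image_subsetI unit_interval_mult[OF x])
    then show "continuous_on {0..1} G" unfolding G_def using a by (intro continuous_intros continuous_on_powr') auto
    fix s :: real assume s: "s \<in> {0<..<1}"
    define u where "u = x * s"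
    have u: "0 \<le> u" using s x by (simp add: u_def)
    have d: "(starlike_bound \<sigma> has_real_derivative
       (- \<sigma> * ((1 - \<sigma>) * (1 + u)\<^sup>2) - (1 - \<sigma> * (1 + u)) * ((1 - \<sigma>) * (2 * (1 + u)))) / ((1 - \<sigma>) * (1 + u)\<^sup>2 * ((1 - \<sigma>) * (1 + u)\<^sup>2))) (at (x * s))"
      (is "(_ has_real_derivative ?D) _")
      unfolding starlike_bound_def u_def[symmetric] using u \<sigma>
      by (auto intro!: derivative_eq_intros)
    have id: "starlike_bound \<sigma> u + u * ?D = starlike_bound_deriv \<sigma> u"
    proof -
      have D: "?D = (- \<sigma> * (1 + u) - 2 * (1 - \<sigma> * (1 + u))) / ((1 - \<sigma>) * (1 + u) ^ 3)"
        using u \<sigma> by (simp add: divide_simps power2_eq_square power3_eq_cube) (simp add: algebra_simps)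
      have B: "starlike_bound \<sigma> u = (1 - \<sigma> * (1 + u)) * (1 + u) / ((1 - \<sigma>) * (1 + u) ^ 3)"
        using u \<sigma> by (simp add: starlike_bound_def power2_eq_square power3_eq_cube)
      show ?thesis unfolding D B starlike_bound_deriv_def
        by (simp add: add_divide_distrib[symmetric] diff_divide_distrib[symmetric]) (simp add: algebra_simps)
    qed
    have dp: "((\<lambda>s. s powr a) has_real_derivative a * s powr (a - 1)) (at s)"
      using s by (intro has_real_derivative_powr) auto
    have dx: "((\<lambda>s. starlike_bound \<sigma> (x * s)) has_real_derivative ?D * x) (at s)"
      by (rule DERIV_chain2[where f = "starlike_bound \<sigma>" and g = "\<lambda>s. x * s", OF d]) (auto intro!: derivative_eq_intros)
    have "(G has_real_derivative a * s powr (a - 1) * starlike_bound \<sigma> (x * s) + ?D * x * s powr a) (at s)"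
      unfolding G_def by (rule DERIV_mult[OF dp dx])
    moreover have "s powr a = s powr (a - 1) * s" using s by (simp add: powr_diff)
    then have "a * s powr (a - 1) * starlike_bound \<sigma> (x * s) + ?D * x * s powr a =
        s powr (a - 1) * ((a - 1) * starlike_bound \<sigma> u + (starlike_bound \<sigma> u + u * ?D))"
      by (simp only: u_def[symmetric]) (simp only: u_def, simp add: algebra_simps)
    then have "a * s powr (a - 1) * starlike_bound \<sigma> (x * s) + ?D * x * s powr a = g s"
      unfolding id by (simp add: g_def u_def algebra_simps)
    ultimately show "(G has_vector_derivative g s) (at s)"
      by (simp add: has_real_derivative_iff_has_vector_derivative)
  qed simp
  moreover have "G 1 - G 0 = starlike_bound \<sigma> x" by (simp add: G_def)
  moreover have "set_integrable lebesgue {0..1} g" unfolding g_def by (rule set_integral_add(1)[OF i1 i2])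
  ultimately have "(LINT s:{0..1}|lebesgue. g s) = starlike_bound \<sigma> x"
    by (simp add: set_lebesgue_integral_eq_integral integral_unique)
  then have "(a - 1) * power_average a (starlike_bound \<sigma>) x + power_average a (starlike_bound_deriv \<sigma>) x = starlike_bound \<sigma> x"
    unfolding g_def set_integral_add(2)[OF i1 i2] by (simp add: power_average_def)
  then show ?thesis by (simp add: algebra_simps)
qed

lemma g_fun_eq_average:
  "g_fun \<sigma> \<mu> \<nu> t = 2 / (\<mu> * \<nu>) * power_average (1 / \<nu>) (power_average (1 / \<mu>) (starlike_bound \<sigma>)) t - 1"
proof -
  have "(LINT s:{0..1}|lebesgue. (1 - \<sigma> * (1 + s * w * t)) / ((1 - \<sigma>) * (1 + s * w * t) ^ 2) * s powr (1 / \<mu> - 1) * w powr (1 / \<nu> - 1))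
     = w powr (1 / \<nu> - 1) * power_average (1 / \<mu>) (starlike_bound \<sigma>) (t * w)" for w
    unfolding power_average_def starlike_bound_def
    by (subst set_integral_mult_right[symmetric]) (simp add: mult_ac)
  then show ?thesis unfolding g_fun_def by (simp add: power_average_def[of "1 / \<nu>"])
qed

lemma q_fun_eq_average:
  "q_fun \<sigma> \<mu> \<nu> t = 1 / (\<mu> * \<nu>) * power_average (1 / \<nu>) (power_average (1 / \<mu>) (starlike_bound_deriv \<sigma>)) t"
proof -
  have "(LINT s:{0..1}|lebesgue. (1 - \<sigma> - (1 + \<sigma>) * s * w * t) / ((1 - \<sigma>) * (1 + s * w * t) ^ 3) * s powr (1 / \<mu> - 1) * w powr (1 / \<nu> - 1))
     = w powr (1 / \<nu> - 1) * power_average (1 / \<mu>) (starlike_bound_deriv \<sigma>) (t * w)" for w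
    unfolding power_average_def starlike_bound_deriv_def
    by (subst set_integral_mult_right[symmetric]) (simp add: mult_ac)
  then show ?thesis unfolding q_fun_def by (simp add: power_average_def[of "1 / \<nu>"])
qed

section \<open>The weight attached to the Pascu class\<close>

text \<open>The product rule applied to \<open>Pi_numerator\<close> yields \<open>- (t powr (1 - 1/\<mu>))\<close> times this weight. In this
  form the derivative of \<open>Pi_fun\<close> is already expressed by \<open>Lambda_fun\<close>, so that integrals against the
  weight need no integration by parts.\<close>

definition pascu_weight :: "(real \<Rightarrow> real) \<Rightarrow> real \<Rightarrow> real \<Rightarrow> real \<Rightarrow> real \<Rightarrow> real" where
  "pascu_weight lam \<mu> \<nu> \<xi> t =
     (1 - \<xi> / \<mu>) * (Pi_fun lam \<mu> \<nu> t * t powr (1 / \<mu> - 1)) + \<xi> * (Lambda_fun lam \<nu> t * t powr (1 / \<nu> - 1))"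

lemma Lambda_fun_eq_tail: "Lambda_fun lam \<nu> = tail_integral (1 / \<nu>) lam"
  by (simp add: fun_eq_iff Lambda_fun_def tail_integral_def)

lemma Pi_fun_eq_tail: "Pi_fun lam \<mu> \<nu> = tail_integral (1 / \<mu>) (\<lambda>x. Lambda_fun lam \<nu> x * x powr (1 / \<nu> - 1))"
  by (simp add: fun_eq_iff Pi_fun_def tail_integral_def powr_diff)

context
  fixes lam :: "real \<Rightarrow> real" and \<mu> \<nu> :: real
  assumes lam: "set_integrable lebesgue {0..1} lam" and \<mu>: "0 < \<mu>" and \<nu>: "0 < \<nu>"
begin

lemma Lambda_fun_powr_integrable: "set_integrable lebesgue {0..1} (\<lambda>x. Lambda_fun lam \<nu> x * x powr (1 / \<nu> - 1))"
  using tail_integral_fubini(1)[of "1 / \<nu>" lam "\<lambda>_. 1"] lam \<nu> by (simp add: Lambda_fun_eq_tail)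

lemma pascu_weight_integrable: "set_integrable lebesgue {0..1} (pascu_weight lam \<mu> \<nu> \<xi>)"
proof -
  have "set_integrable lebesgue {0..1} (\<lambda>t. Pi_fun lam \<mu> \<nu> t * t powr (1 / \<mu> - 1))"
    using tail_integral_fubini(1)[OF _ Lambda_fun_powr_integrable, of "1 / \<mu>" "\<lambda>_. 1"] \<mu> by (simp add: Pi_fun_eq_tail)
  then show ?thesis unfolding pascu_weight_def
    by (intro set_integral_add set_integrable_mult_right Lambda_fun_powr_integrable)
qed

lemma integral_pascu_weight:
  assumes \<psi>: "continuous_on {0..1} \<psi>"
  shows "(LINT t:{0..1}|lebesgue. pascu_weight lam \<mu> \<nu> \<xi> t * \<psi> t) =
    (LINT x:{0..1}|lebesgue. lam x * ((1 - \<xi> / \<mu>) * power_average (1 / \<nu>) (power_average (1 / \<mu>) \<psi>) x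
       + \<xi> * power_average (1 / \<nu>) \<psi> x))"
proof -
  define L where "L = (\<lambda>x. Lambda_fun lam \<nu> x * x powr (1 / \<nu> - 1))"
  have a: "0 < 1 / \<mu>" "0 < 1 / \<nu>" using \<mu> \<nu> by auto
  have c: "continuous_on {0..1} (power_average (1 / \<mu>) \<psi>)" by (rule power_average_continuous[OF a(1) \<psi>])
  have iL: "set_integrable lebesgue {0..1} L" unfolding L_def by (rule Lambda_fun_powr_integrable)
  have P: "set_integrable lebesgue {0..1} (\<lambda>t. Pi_fun lam \<mu> \<nu> t * t powr (1 / \<mu> - 1) * \<psi> t)"
    "(LINT t:{0..1}|lebesgue. Pi_fun lam \<mu> \<nu> t * t powr (1 / \<mu> - 1) * \<psi> t) = (LINT x:{0..1}|lebesgue. L x * power_average (1 / \<mu>) \<psi> x)"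
    using tail_integral_fubini[OF a(1) iL \<psi>] unfolding Pi_fun_eq_tail L_def by auto
  have L1: "set_integrable lebesgue {0..1} (\<lambda>t. L t * \<eta> t)"
    "(LINT t:{0..1}|lebesgue. L t * \<eta> t) = (LINT x:{0..1}|lebesgue. lam x * power_average (1 / \<nu>) \<eta> x)"
    if "continuous_on {0..1} \<eta>" for \<eta>
    using tail_integral_fubini[OF a(2) lam that] unfolding Lambda_fun_eq_tail L_def by auto
  have i: "set_integrable lebesgue {0..1} (\<lambda>x. lam x * power_average (1 / \<nu>) \<eta> x)" if "continuous_on {0..1} \<eta>" for \<eta>
    using set_integrable_mult_continuous[OF lam power_average_continuous[OF a(2) that]] by simp
  have "(LINT t:{0..1}|lebesgue. pascu_weight lam \<mu> \<nu> \<xi> t * \<psi> t) =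
     (LINT t:{0..1}|lebesgue. (1 - \<xi> / \<mu>) * (Pi_fun lam \<mu> \<nu> t * t powr (1 / \<mu> - 1) * \<psi> t) + \<xi> * (L t * \<psi> t))"
    by (intro set_lebesgue_integral_cong) (auto simp: pascu_weight_def L_def algebra_simps)
  also have "\<dots> = (1 - \<xi> / \<mu>) * (LINT t:{0..1}|lebesgue. Pi_fun lam \<mu> \<nu> t * t powr (1 / \<mu> - 1) * \<psi> t) + \<xi> * (LINT t:{0..1}|lebesgue. L t * \<psi> t)"
    by (subst set_integral_add(2)[OF set_integrable_mult_right[OF P(1)] set_integrable_mult_right[OF L1(1)[OF \<psi>]]])
       (simp only: set_integral_mult_right)
  also have "\<dots> = (1 - \<xi> / \<mu>) * (LINT x:{0..1}|lebesgue. lam x * power_average (1 / \<nu>) (power_average (1 / \<mu>) \<psi>) x)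
       + \<xi> * (LINT x:{0..1}|lebesgue. lam x * power_average (1 / \<nu>) \<psi> x)"
    by (simp only: P(2) L1(2)[OF c] L1(2)[OF \<psi>])
  also have "\<dots> = (LINT x:{0..1}|lebesgue. (1 - \<xi> / \<mu>) * (lam x * power_average (1 / \<nu>) (power_average (1 / \<mu>) \<psi>) x)
       + \<xi> * (lam x * power_average (1 / \<nu>) \<psi> x))"
    by (subst set_integral_add(2)[OF set_integrable_mult_right[OF i[OF c]] set_integrable_mult_right[OF i[OF \<psi>]]])
       (simp only: set_integral_mult_right)
  also have "\<dots> = (LINT x:{0..1}|lebesgue. lam x * ((1 - \<xi> / \<mu>) * power_average (1 / \<nu>) (power_average (1 / \<mu>) \<psi>) x
       + \<xi> * power_average (1 / \<nu>) \<psi> x))"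
    by (intro set_lebesgue_integral_cong) (auto simp: algebra_simps)
  finally show ?thesis .
qed

text \<open>The two averages of \<open>t\<^sup>m\<close> contribute \<open>\<mu>/(1 + \<mu>m)\<close> and \<open>\<nu>/(1 + \<nu>m)\<close>, and
  \<open>(1 - \<xi>/\<mu>) \<mu>/(1 + \<mu>m) + \<xi> = \<mu>(1 + \<xi>m)/(1 + \<mu>m)\<close>.\<close>

lemma pascu_weight_moment:
  "(LINT t:{0..1}|lebesgue. pascu_weight lam \<mu> \<nu> \<xi> t * t ^ m) =
     \<mu> * \<nu> * (1 + \<xi> * real m) / ((1 + \<mu> * real m) * (1 + \<nu> * real m)) * (LINT t:{0..1}|lebesgue. lam t * t ^ m)"
proof -
  have p: "1 + \<mu> * real m > 0" "1 + \<nu> * real m > 0" using \<mu> \<nu> by (auto intro: add_pos_nonneg)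
  have e: "1 / \<mu> + real m = (1 + \<mu> * real m) / \<mu>" "1 / \<nu> + real m = (1 + \<nu> * real m) / \<nu>"
    using \<mu> \<nu> by (auto simp: field_simps)
  have "power_average (1 / \<mu>) (\<lambda>t. t ^ m) = (\<lambda>x. \<mu> / (1 + \<mu> * real m) * x ^ m)"
    using \<mu> by (simp add: fun_eq_iff power_average_monomial e)
  then have "(1 - \<xi> / \<mu>) * power_average (1 / \<nu>) (power_average (1 / \<mu>) (\<lambda>t. t ^ m)) x + \<xi> * power_average (1 / \<nu>) (\<lambda>t. t ^ m) x
     = \<mu> * \<nu> * (1 + \<xi> * real m) / ((1 + \<mu> * real m) * (1 + \<nu> * real m)) * x ^ m" for x
  proof -
    assume h: "power_average (1 / \<mu>) (\<lambda>t. t ^ m) = (\<lambda>x. \<mu> / (1 + \<mu> * real m) * x ^ m)"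
    have "(1 - \<xi> / \<mu>) * (\<mu> / (1 + \<mu> * real m) * (x ^ m / ((1 + \<nu> * real m) / \<nu>))) + \<xi> * (x ^ m / ((1 + \<nu> * real m) / \<nu>))
      = ((1 - \<xi> / \<mu>) * (\<mu> / (1 + \<mu> * real m)) + \<xi>) * (\<nu> / (1 + \<nu> * real m) * x ^ m)" by (simp add: algebra_simps)
    also have "(1 - \<xi> / \<mu>) * (\<mu> / (1 + \<mu> * real m)) + \<xi> = \<mu> * (1 + \<xi> * real m) / (1 + \<mu> * real m)"
      using p \<mu> by (simp add: divide_simps) (simp add: algebra_simps)
    finally show ?thesis using \<nu> unfolding h power_average_cmult by (simp add: power_average_monomial e)
  qed
  moreover have "continuous_on {0..1} (\<lambda>t::real. t ^ m)" by (intro continuous_intros)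
  ultimately show ?thesis
    by (simp only: integral_pascu_weight mult.left_commute[of "lam _"] set_integral_mult_right)
qed

text \<open>This rewrites the right-hand side of the equation that determines \<open>\<beta>\<close>. By parts, the average
  with exponent \<open>1/\<mu>\<close> in \<open>q_fun\<close> becomes \<open>B + (1 - 1/\<mu>)\<close> times the one in \<open>g_fun\<close>, where \<open>B\<close> is the
  starlike bound; the combination with factors \<open>1 - \<xi>\<close> and \<open>\<xi>\<close> is then the one produced by the weight.\<close>

lemma integral_pascu_weight_starlike_bound:
  assumes \<sigma>: "\<sigma> < 1" and one: "(LINT t:{0..1}|lebesgue. lam t) = 1"
  shows "(LINT t:{0..1}|lebesgue. lam t * ((1 - \<xi>) * g_fun \<sigma> \<mu> \<nu> t + \<xi> * (2 * q_fun \<sigma> \<mu> \<nu> t - 1))) =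
    2 / (\<mu> * \<nu>) * (LINT t:{0..1}|lebesgue. pascu_weight lam \<mu> \<nu> \<xi> t * starlike_bound \<sigma> t) - 1"
proof -
  define A where "A = power_average (1 / \<nu>) (power_average (1 / \<mu>) (starlike_bound \<sigma>))"
  define B where "B = power_average (1 / \<nu>) (starlike_bound \<sigma>)"
  have a: "0 < 1 / \<mu>" "0 < 1 / \<nu>" using \<mu> \<nu> by auto
  note cb = starlike_bound_continuous[OF \<sigma>]
  note cA = power_average_continuous[OF a(1) cb]
  define h where "h = (\<lambda>x. (1 - \<xi> / \<mu>) * A x + \<xi> * B x)"
  have ch: "continuous_on {0..1} h" unfolding h_def A_def B_def
    by (intro continuous_intros power_average_continuous a cb)
  have i: "set_integrable lebesgue {0..1} (\<lambda>t. 2 / (\<mu> * \<nu>) * (lam t * h t))"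
    using set_integrable_mult_continuous[OF lam ch] by (intro set_integrable_mult_right) simp
  have "(1 - \<xi>) * g_fun \<sigma> \<mu> \<nu> t + \<xi> * (2 * q_fun \<sigma> \<mu> \<nu> t - 1) = 2 / (\<mu> * \<nu>) * h t - 1" if t: "t \<in> {0..1}" for t
  proof -
    have "power_average (1 / \<nu>) (power_average (1 / \<mu>) (starlike_bound_deriv \<sigma>)) t =
       power_average (1 / \<nu>) (\<lambda>x. starlike_bound \<sigma> x + (1 - 1 / \<mu>) * power_average (1 / \<mu>) (starlike_bound \<sigma>) x) t"
      by (rule power_average_cong[OF power_average_by_parts[OF a(1) \<sigma>] t])
    also have "\<dots> = B t + (1 - 1 / \<mu>) * A t"
      unfolding A_def B_def using t a
      by (subst power_average_add) (auto intro!: continuous_intros cb cA simp: power_average_cmult)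
    finally have q: "q_fun \<sigma> \<mu> \<nu> t = 1 / (\<mu> * \<nu>) * (B t + (1 - 1 / \<mu>) * A t)" by (simp add: q_fun_eq_average)
    have g: "g_fun \<sigma> \<mu> \<nu> t = 2 / (\<mu> * \<nu>) * A t - 1" by (simp add: g_fun_eq_average A_def)
    show ?thesis unfolding q g h_def
      by (simp add: algebra_simps add_divide_distrib diff_divide_distrib)
  qed
  then have "(LINT t:{0..1}|lebesgue. lam t * ((1 - \<xi>) * g_fun \<sigma> \<mu> \<nu> t + \<xi> * (2 * q_fun \<sigma> \<mu> \<nu> t - 1))) =
     (LINT t:{0..1}|lebesgue. 2 / (\<mu> * \<nu>) * (lam t * h t) - lam t)"
    by (intro set_lebesgue_integral_cong) (auto simp: right_diff_distrib)
  also have "\<dots> = 2 / (\<mu> * \<nu>) * (LINT t:{0..1}|lebesgue. lam t * h t) - 1"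
    by (subst set_integral_diff(2)[OF i lam]) (simp only: set_integral_mult_right one)
  also have "(LINT t:{0..1}|lebesgue. lam t * h t) = (LINT t:{0..1}|lebesgue. pascu_weight lam \<mu> \<nu> \<xi> t * starlike_bound \<sigma> t)"
    unfolding h_def A_def B_def by (rule integral_pascu_weight[OF cb, symmetric])
  finally show ?thesis .
qed

lemma Pi_numerator_eq_pascu_weight:
  assumes t: "0 < t" "t < 1" and \<xi>: "0 \<le> \<xi>"
  shows "t powr (1 / \<mu> - 1) * - Pi_numerator lam \<mu> \<nu> \<xi> t = pascu_weight lam \<mu> \<nu> \<xi> t"
proof (cases "\<xi> = 0")
  case True
  then show ?thesis by (simp add: Pi_numerator_def pascu_weight_def)
next
  case False
  define L where "L = (\<lambda>x. Lambda_fun lam \<nu> x * x powr (1 / \<nu> - 1))"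
  define Pf where "Pf = Pi_fun lam \<mu> \<nu>"
  define e where "e = 1 / \<mu> - 1 / \<xi>"
  have "continuous_on {c..1} L" if "0 < c" for c
    unfolding L_def Lambda_fun_eq_tail using that
    by (intro continuous_intros tail_integral_continuous lam) auto
  then have "(Pf has_real_derivative - (L t / t powr (1 / \<mu>))) (at t)"
    unfolding Pf_def Pi_fun_eq_tail L_def[symmetric]
    using tail_integral_has_derivative[of L t "1 / \<mu>"] Lambda_fun_powr_integrable t by (simp add: L_def)
  moreover have "((\<lambda>x. x powr e) has_real_derivative e * t powr (e - 1)) (at t)"
    using t by (intro has_real_derivative_powr) auto
  ultimately have "((\<lambda>x. x powr e * Pf x) has_real_derivative e * t powr (e - 1) * Pf t + - (L t / t powr (1 / \<mu>)) * t powr e) (at t)"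
    by (rule DERIV_mult[rotated])
  then have d: "deriv (\<lambda>x. x powr e * Pf x) t = e * t powr (e - 1) * Pf t - L t / t powr (1 / \<mu>) * t powr e"
    by (simp add: DERIV_imp_deriv)
  have "t powr (1 / \<xi> - 1 / \<mu> + 1) * t powr (e - 1) = 1" "t powr (1 / \<xi> - 1 / \<mu> + 1) * t powr e = t"
    using t by (simp_all add: powr_add[symmetric] e_def)
  then have "t powr (1 / \<xi> - 1 / \<mu> + 1) * deriv (\<lambda>x. x powr e * Pf x) t = e * Pf t - L t / t powr (1 / \<mu>) * t"
    unfolding d right_diff_distrib by (simp add: mult_ac)
  then have "Pi_numerator lam \<mu> \<nu> \<xi> t = \<xi> * (e * Pf t - L t / t powr (1 / \<mu>) * t)"
    using False by (simp add: Pi_numerator_def e_def Pf_def mult.assoc)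
  moreover have "\<xi> * e = \<xi> / \<mu> - 1" using False \<mu> by (simp add: e_def field_simps)
  ultimately have "- Pi_numerator lam \<mu> \<nu> \<xi> t = (1 - \<xi> / \<mu>) * Pf t + \<xi> * (L t / t powr (1 / \<mu>) * t)"
    by (simp add: right_diff_distrib mult.assoc[symmetric]) (simp add: algebra_simps)
  moreover have "t powr (1 / \<mu> - 1) * (L t / t powr (1 / \<mu>) * t) = L t"
    using t by (simp add: powr_diff)
  moreover have "T * ((1 - \<xi> / \<mu>) * Pf t + \<xi> * Y) = (1 - \<xi> / \<mu>) * (Pf t * T) + \<xi> * (T * Y)" for T Y
    by (simp add: algebra_simps)
  ultimately show ?thesis by (simp only: pascu_weight_def Pf_def L_def)
qed

end

text \<open>The factor is
  \<open>k(t) = t\<^bsup>1/\<mu>-1\<^esup> (N(t) / log(1/t)\<^bsup>1+2\<sigma>\<^esup>) log(1/t)\<^bsup>2\<sigma>\<^esup>\<close> with \<open>N\<close> the negative of \<open>Pi_numerator\<close>: a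
  product of three non-negative non-increasing functions, the middle one by the monotonicity hypothesis.\<close>

lemma pascu_weight_factorization:
  assumes \<sigma>: "0 \<le> \<sigma>" and \<mu>: "1 \<le> \<mu>" and \<nu>: "0 < \<nu>" and \<xi>: "0 \<le> \<xi>" "\<xi> \<le> 1"
    and lam: "set_integrable lebesgue {0..1} lam"
    and L: "\<And>t. t \<in> {0<..<1} \<Longrightarrow> Lambda_fun lam \<nu> t > 0"
    and P: "\<And>t. t \<in> {0<..<1} \<Longrightarrow> Pi_fun lam \<mu> \<nu> t > 0"
    and mono: "mono_on {0<..<1} (\<lambda>t. Pi_numerator lam \<mu> \<nu> \<xi> t / ln (1 / t) powr (1 + 2 * \<sigma>))"
  obtains k where "\<And>t. 0 < t \<Longrightarrow> t < 1 \<Longrightarrow> pascu_weight lam \<mu> \<nu> \<xi> t = k t * ln (1 / t)"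
    "\<And>t. 0 < t \<Longrightarrow> t < 1 \<Longrightarrow> 0 \<le> k t"
    "\<And>s t. 0 < s \<Longrightarrow> s \<le> t \<Longrightarrow> t < 1 \<Longrightarrow> k t \<le> k s"
proof -
  define N where "N = (\<lambda>t. - Pi_numerator lam \<mu> \<nu> \<xi> t)"
  define l where "l = (\<lambda>t::real. ln (1 / t))"
  define R where "R = (\<lambda>t. N t / l t powr (1 + 2 * \<sigma>))"
  define k where "k = (\<lambda>t. t powr (1 / \<mu> - 1) * (R t * l t powr (2 * \<sigma>)))"
  have l: "0 < l t" if "0 < t" "t < 1" for t using that by (simp add: l_def)
  have W: "t powr (1 / \<mu> - 1) * N t = pascu_weight lam \<mu> \<nu> \<xi> t" if "0 < t" "t < 1" for t
    unfolding N_def using Pi_numerator_eq_pascu_weight[OF lam _ \<nu> that \<xi>(1)] \<mu> by simp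
  have W0: "0 \<le> pascu_weight lam \<mu> \<nu> \<xi> t" if "0 < t" "t < 1" for t
  proof -
    have "\<xi> / \<mu> \<le> 1" using \<mu> \<xi> by simp
    then show ?thesis unfolding pascu_weight_def using L[of t] P[of t] that \<xi>
      by (intro add_nonneg_nonneg mult_nonneg_nonneg) auto
  qed
  have N0: "0 \<le> N t" if "0 < t" "t < 1" for t
    using W0[OF that] W[OF that] that by (metis powr_gt_zero zero_le_mult_iff less_imp_not_less order_less_irrefl less_le_not_le)
  have R0: "0 \<le> R t" if "0 < t" "t < 1" for t unfolding R_def using N0[OF that] by simp
  show ?thesis
  proof (rule that[of k])
    fix t :: real assume t: "0 < t" "t < 1"
    have "l t powr (1 + 2 * \<sigma>) = l t * l t powr (2 * \<sigma>)" using l[OF t] by (simp add: powr_add)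
    then have "R t * l t powr (2 * \<sigma>) * l t = N t" using l[OF t] by (simp add: R_def)
    then show "pascu_weight lam \<mu> \<nu> \<xi> t = k t * ln (1 / t)"
      unfolding W[OF t, symmetric] k_def by (simp add: mult.assoc l_def)
    show "0 \<le> k t" unfolding k_def using R0[OF t] by simp
  next
    fix s t :: real assume st: "0 < s" "s \<le> t" "t < 1"
    have "R t \<le> R s" using mono_onD[OF mono, of s t] st by (simp add: R_def N_def l_def)
    moreover have "t powr (1 / \<mu> - 1) \<le> s powr (1 / \<mu> - 1)" using st \<mu> by (intro powr_mono2') auto
    moreover have "l t \<le> l s" using st unfolding l_def by (subst ln_le_cancel_iff) (auto intro!: divide_left_mono)
    then have "l t powr (2 * \<sigma>) \<le> l s powr (2 * \<sigma>)" using st \<sigma> l[of t] by (intro powr_mono2) auto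
    ultimately show "k t \<le> k s" unfolding k_def
      using R0[of t] R0[of s] st by (intro mult_mono mult_nonneg_nonneg) auto
  qed
qed

section \<open>Power series on the unit disc and Hadamard products\<close>

lemma power_series_on_disc:
  fixes c :: "nat \<Rightarrow> complex"
  assumes f: "\<And>z. norm z < 1 \<Longrightarrow> (\<lambda>n. c n * z ^ n) sums f z"
  shows "f holomorphic_on ball 0 1"
    and "norm z < 1 \<Longrightarrow> (\<lambda>n. of_nat (Suc n) * c (Suc n) * z ^ n) sums deriv f z"
    and "norm z < 1 \<Longrightarrow> (\<lambda>n. of_nat n * c n * z ^ n) sums (z * deriv f z)"
    and "norm z < 1 \<Longrightarrow> summable (\<lambda>n. norm (c n * z ^ n))"
    and "f 0 = c 0"
proof -
  show hol: "f holomorphic_on ball 0 1"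
    by (rule power_series_holomorphic[where a = c]) (use f in auto)
  show *: "(\<lambda>n. of_nat (Suc n) * c (Suc n) * z ^ n) sums deriv f z" if "norm z < 1" for z
  proof -
    have "(f has_field_derivative deriv f z) (at z)"
      using hol that by (intro holomorphic_derivI[of f "ball 0 1"]) auto
    from termdiffs_sums_strong[OF f this that] show ?thesis by (simp add: diffs_def)
  qed
  show "(\<lambda>n. of_nat n * c n * z ^ n) sums (z * deriv f z)" if "norm z < 1" for z
  proof -
    have "(\<lambda>n. of_nat (Suc n) * c (Suc n) * z ^ Suc n) sums (z * deriv f z)"
      using sums_mult[OF *[OF that], of z] by (simp add: mult_ac)
    then show ?thesis by (subst (asm) sums_Suc_iff) simp
  qed
  show "summable (\<lambda>n. norm (c n * z ^ n))" if z: "norm z < 1" for z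
  proof -
    define w where "w = complex_of_real ((1 + norm z) / 2)"
    have "norm w = (1 + norm z) / 2" unfolding w_def norm_of_real by simp
    then have w: "norm z < norm w" "norm w < 1" using z by auto
    show ?thesis by (rule powser_insidea[OF sums_summable[OF f[OF w(2)]] w(1)])
  qed
  show "f 0 = c 0" using sums_unique2[OF f[of 0] powser_sums_zero[of c]] by simp
qed

text \<open>Termwise integration against an integrable weight; it serves both for means over the circle,
  where the weight is \<open>1\<close>, and for integrals of power series in \<open>t z\<close> over \<open>t\<close>.\<close>

lemma integral_dominated_sums:
  fixes g :: "nat \<Rightarrow> real \<Rightarrow> complex"
  assumes W: "set_integrable lebesgue {0..1} W"
    and g: "\<And>n. continuous_on {0..1} (g n)"
    and B: "\<And>n t. t \<in> {0..1} \<Longrightarrow> norm (g n t) \<le> B n" "summable B"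
  shows "(\<lambda>n. LINT t:{0..1}|lebesgue. W t *\<^sub>R g n t) sums (LINT t:{0..1}|lebesgue. W t *\<^sub>R (\<Sum>n. g n t))"
proof -
  define F where "F = (\<lambda>n t. indicator {0..1} t *\<^sub>R (W t *\<^sub>R g n t))"
  have i: "integrable lebesgue (F n)" for n
    using set_integrable_mult_continuous[OF W g, of n] by (simp add: F_def set_integrable_def)
  have Wi: "integrable lebesgue (\<lambda>t. \<bar>indicator {0..1} t * W t\<bar>)"
    using W by (intro integrable_abs) (simp add: set_integrable_def)
  have nF: "norm (F n t) \<le> \<bar>indicator {0..1} t * W t\<bar> * B n" for n t
    using B(1)[of t n] by (cases "t \<in> {0..1}") (auto simp: F_def intro: mult_left_mono)
  have "(\<lambda>n. integral\<^sup>L lebesgue (F n)) sums (\<integral>t. (\<Sum>n. F n t) \<partial>lebesgue)"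
  proof (rule sums_integral[OF i])
    show "AE t in lebesgue. summable (\<lambda>n. norm (F n t))"
      by (intro AE_I2 summable_comparison_test'[OF summable_mult[OF B(2)]]) (use nF in simp)
    have "(\<integral>t. norm (F n t) \<partial>lebesgue) \<le> (\<integral>t. \<bar>indicator {0..1} t * W t\<bar> * B n \<partial>lebesgue)" for n
      using i Wi nF by (intro integral_mono integrable_norm integrable_mult_left) auto
    then have "norm (\<integral>t. norm (F n t) \<partial>lebesgue) \<le> (\<integral>t. \<bar>indicator {0..1} t * W t\<bar> \<partial>lebesgue) * B n" for n
      by simp
    then show "summable (\<lambda>n. \<integral>t. norm (F n t) \<partial>lebesgue)"
      by (intro summable_comparison_test'[OF summable_mult[OF B(2)]])
  qed
  moreover have "(\<Sum>n. F n t) = indicator {0..1} t *\<^sub>R (W t *\<^sub>R (\<Sum>n. g n t))" for t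
  proof (cases "t \<in> {0..1}")
    case True
    have "summable (\<lambda>n. g n t)"
      by (rule summable_comparison_test'[OF B(2)]) (use B(1)[OF True] in auto)
    then show ?thesis using True by (simp add: F_def suminf_scaleR_right[symmetric])
  qed (simp add: F_def)
  ultimately show ?thesis by (simp add: F_def set_lebesgue_integral_def)
qed

abbreviation circle_char :: "int \<Rightarrow> real \<Rightarrow> complex" where
  "circle_char k t \<equiv> cis (2 * pi * of_int k * t)"

lemma circle_char_continuous: "continuous_on A (circle_char k)"
  unfolding cis_conv_exp by (intro continuous_intros)

lemma circle_char_integral:
  "(LINT t:{0..1}|lebesgue. circle_char k t) = (if k = 0 then 1 else 0)"
proof (cases "k = 0")
  case True
  then show ?thesis by (simp add: set_lebesgue_integral_def)
next
  case False
  define c where "c = 2 * pi * of_int k"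
  have c: "c \<noteq> 0" using False by (simp add: c_def)
  define G where "G = (\<lambda>t. exp (\<i> * of_real (c * t)) / (\<i> * of_real c))"
  have "((\<lambda>t. circle_char k t) has_integral (G 1 - G 0)) {0..1}"
  proof (rule fundamental_theorem_of_calculus)
    fix t :: real
    have "((\<lambda>t. exp (\<i> * of_real c * t) / (\<i> * of_real c)) has_field_derivative exp (\<i> * of_real c * of_real t)) (at (of_real t))"
      using c by (auto intro!: derivative_eq_intros)
    then have "((\<lambda>t. exp (\<i> * of_real c * of_real t) / (\<i> * of_real c)) has_vector_derivative exp (\<i> * of_real c * of_real t)) (at t within {0..1})"
      by (rule has_vector_derivative_real_field)
    then show "(G has_vector_derivative circle_char k t) (at t within {0..1})"
      by (simp add: G_def cis_conv_exp c_def mult.assoc)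
  qed simp
  moreover have "G 1 = G 0"
  proof -
    have "exp (\<i> * of_real (c * 1)) = cis (2 * pi * of_int k)" by (simp add: cis_conv_exp c_def)
    also have "\<dots> = 1" by (rule cis_multiple_2pi) simp
    finally show ?thesis by (simp add: G_def)
  qed
  ultimately have "integral {0..1} (circle_char k) = 0" by (simp add: integral_unique)
  then show ?thesis
    using False set_lebesgue_integral_eq_integral(2)[OF absolutely_integrable_continuous_real[OF circle_char_continuous], of 0 1 k] by simp
qed

lemma circle_mean_sums:
  assumes F: "continuous_on {0..1} F" and b: "summable (\<lambda>n. norm (b n))"
  shows "(\<lambda>n. b n * (LINT t:{0..1}|lebesgue. F t * circle_char (k n) t)) sums
     (LINT t:{0..1}|lebesgue. F t * (\<Sum>n. b n * circle_char (k n) t))"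
proof -
  have "bounded (F ` {0..1})" using F by (intro compact_imp_bounded compact_continuous_image) auto
  then obtain C where C: "\<forall>t\<in>{0..1}. norm (F t) \<le> C" by (auto simp: bounded_iff)
  have W: "set_integrable lebesgue {0..1} (\<lambda>t::real. 1 :: real)"
    by (intro absolutely_integrable_continuous_real continuous_intros)
  have "(\<lambda>n. LINT t:{0..1}|lebesgue. 1 *\<^sub>R (F t * (b n * circle_char (k n) t))) sums
     (LINT t:{0..1}|lebesgue. 1 *\<^sub>R (\<Sum>n. F t * (b n * circle_char (k n) t)))"
  proof (rule integral_dominated_sums[OF W])
    show "continuous_on {0..1} (\<lambda>t. F t * (b n * circle_char (k n) t))" for n
      by (intro continuous_intros F circle_char_continuous)
    show "summable (\<lambda>n. C * norm (b n))" using b by (rule summable_mult)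
    show "norm (F t * (b n * circle_char (k n) t)) \<le> C * norm (b n)" if "t \<in> {0..1}" for n t
      using C that by (simp add: norm_mult mult_right_mono)
  qed
  moreover have "(\<Sum>n. F t * (b n * circle_char (k n) t)) = F t * (\<Sum>n. b n * circle_char (k n) t)" for t
  proof (rule suminf_mult)
    show "summable (\<lambda>n. b n * circle_char (k n) t)"
      by (rule summable_norm_cancel) (use b in \<open>simp add: norm_mult\<close>)
  qed
  moreover have "(LINT t:{0..1}|lebesgue. F t * (b n * circle_char (k n) t)) = b n * (LINT t:{0..1}|lebesgue. F t * circle_char (k n) t)" for n
    by (subst set_integral_mult_right[symmetric]) (simp add: mult_ac)
  ultimately show ?thesis by simp
qed

text \<open>Choose \<open>|z| < \<rho> < 1\<close> and \<open>\<zeta> = z/\<rho>\<close>. On the circle put \<open>u = \<rho> e\<close> and \<open>v = \<zeta>/e\<close> for \<open>|e| = 1\<close>, and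
  \<open>R = 2 Q(v) - d\<^sub>0\<close>, which has non-negative real part and mean \<open>d\<^sub>0\<close>. By orthogonality the mean of
  \<open>P(u) R\<close> is \<open>2 S - d\<^sub>0 p\<^sub>0\<close> and that of \<open>cnj (P(u)) R\<close> is \<open>d\<^sub>0 cnj p\<^sub>0\<close>. Adding the two, the mean of
  \<open>2 Re (P(u)) Re R\<close> equals \<open>2 Re S\<close>, and it is positive as \<open>Re P\<close> is bounded below on the circle.\<close>

lemma hadamard_product_real_part_pos:
  fixes p d :: "nat \<Rightarrow> complex"
  assumes P: "\<And>z. norm z < 1 \<Longrightarrow> (\<lambda>n. p n * z ^ n) sums P z"
    and Q: "\<And>z. norm z < 1 \<Longrightarrow> (\<lambda>n. d n * z ^ n) sums Q z"
    and ReP: "\<And>z. norm z < 1 \<Longrightarrow> 0 < Re (P z)"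
    and ReQ: "\<And>z. norm z < 1 \<Longrightarrow> Re (d 0) / 2 \<le> Re (Q z)"
    and d0: "d 0 \<in> \<real>" "0 < Re (d 0)"
    and z: "norm z < 1" and S: "(\<lambda>n. p n * d n * z ^ n) sums S"
  shows "0 < Re S"
proof -
  define \<rho> where "\<rho> = (1 + norm z) / 2"
  have \<rho>: "0 < \<rho>" "\<rho> < 1" "norm z < \<rho>" using z by (auto simp: \<rho>_def intro: add_pos_nonneg)
  define \<zeta> where "\<zeta> = z / of_real \<rho>"
  have \<zeta>: "norm \<zeta> < 1" using \<rho> by (simp add: \<zeta>_def norm_divide)
  have z\<zeta>: "z = of_real \<rho> * \<zeta>" using \<rho> by (simp add: \<zeta>_def)
  define PP where "PP = (\<lambda>t. P (of_real \<rho> * circle_char 1 t))"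
  define R where "R = (\<lambda>t. 2 * Q (\<zeta> * circle_char (-1) t) - d 0)"
  define b where "b = (\<lambda>n. if n = 0 then d 0 else 2 * d n * \<zeta> ^ n)"
  have cis_pow: "circle_char 1 t ^ n = circle_char (int n) t" "circle_char (-1) t ^ n = circle_char (- int n) t" for n t
    unfolding Complex.DeMoivre by (simp_all add: mult_ac)
  have charmult: "circle_char j t * circle_char k t = circle_char (j + k) t" for j k t
    by (simp add: cis_mult algebra_simps)
  have n\<rho>: "norm (of_real \<rho> * circle_char 1 t) < 1" "norm (\<zeta> * circle_char (-1) t) < 1" for t
    using \<rho> \<zeta> by (auto simp: norm_mult)
  have PPs: "PP t = (\<Sum>n. p n * of_real \<rho> ^ n * circle_char (int n) t)" for t
    using sums_unique[OF P[OF n\<rho>(1)], of t] unfolding PP_def power_mult_distrib cis_pow by (simp only: mult.assoc)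
  have bs: "summable (\<lambda>n. norm (b n))"
  proof -
    have "summable (\<lambda>n. norm (d n * \<zeta> ^ n))" using Q \<zeta> by (rule power_series_on_disc(4))
    then have "summable (\<lambda>n. 2 * norm (d n * \<zeta> ^ n))" by (rule summable_mult)
    then show ?thesis
      by (rule summable_comparison_test'[where N = 1]) (simp add: b_def norm_mult)
  qed
  have Rs: "(\<lambda>n. b n * circle_char (- int n) t) sums R t" for t
  proof -
    have "(\<lambda>n. 2 * (d n * (\<zeta> * circle_char (-1) t) ^ n)) sums (2 * Q (\<zeta> * circle_char (-1) t))"
      using Q[OF n\<rho>(2)] by (rule sums_mult)
    moreover have "(\<lambda>n. if n = 0 then d 0 else 0) sums d 0"
      using sums_single[of 0 "\<lambda>_. d 0"] by simp
    ultimately have "(\<lambda>n. 2 * (d n * (\<zeta> * circle_char (-1) t) ^ n) - (if n = 0 then d 0 else 0)) sums R t"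
      unfolding R_def by (rule sums_diff)
    moreover have "2 * (d n * (\<zeta> * circle_char (-1) t) ^ n) - (if n = 0 then d 0 else 0) = b n * circle_char (- int n) t" for n
      unfolding power_mult_distrib cis_pow by (simp add: b_def)
    ultimately show ?thesis by simp
  qed
  then have Rs': "R t = (\<Sum>n. b n * circle_char (- int n) t)" for t by (simp add: sums_iff)
  have hP: "P holomorphic_on ball 0 1" and hQ: "Q holomorphic_on ball 0 1"
    by (rule power_series_on_disc(1), fact P) (rule power_series_on_disc(1), fact Q)
  have cP: "continuous_on {0..1} PP" unfolding PP_def
    by (rule continuous_on_compose2[OF holomorphic_on_imp_continuous_on[OF hP]])
       (use n\<rho> in \<open>auto intro!: continuous_intros circle_char_continuous\<close>)
  have cR: "continuous_on {0..1} R" unfolding R_def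
    by (intro continuous_intros continuous_on_compose2[OF holomorphic_on_imp_continuous_on[OF hQ]] circle_char_continuous)
       (use n\<rho> in auto)
  have sp: "summable (\<lambda>n. norm (p n * of_real \<rho> ^ n))"
    by (rule power_series_on_disc(4), fact P) (use \<rho> in simp)
  have coeff: "(LINT t:{0..1}|lebesgue. PP t * circle_char k t) = (if k \<le> 0 then p (nat (- k)) * of_real \<rho> ^ nat (- k) else 0)" for k
  proof -
    have "(\<lambda>n. p n * of_real \<rho> ^ n * (LINT t:{0..1}|lebesgue. circle_char k t * circle_char (int n) t)) sums
       (LINT t:{0..1}|lebesgue. circle_char k t * (\<Sum>n. p n * of_real \<rho> ^ n * circle_char (int n) t))"
      by (rule circle_mean_sums[OF circle_char_continuous sp])
    then have s: "(\<lambda>n. p n * of_real \<rho> ^ n * (if k + int n = 0 then 1 else 0)) sums (LINT t:{0..1}|lebesgue. PP t * circle_char k t)"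
      unfolding PPs[symmetric] charmult circle_char_integral by (simp only: mult.commute)
    have "(\<lambda>n. p n * of_real \<rho> ^ n * (if k + int n = 0 then 1 else 0)) = (\<lambda>n. if n = nat (- k) \<and> k \<le> 0 then p n * of_real \<rho> ^ n else 0)"
      by (auto simp: fun_eq_iff)
    also have "\<dots> sums (if k \<le> 0 then p (nat (- k)) * of_real \<rho> ^ nat (- k) else 0)"
      using sums_single[of "nat (- k)" "\<lambda>n. p n * of_real \<rho> ^ n"] by (cases "k \<le> 0") auto
    finally show ?thesis using s sums_unique2 by blast
  qed
  have cnjcoeff: "(LINT t:{0..1}|lebesgue. cnj (PP t) * circle_char (- int n) t) = (if n = 0 then cnj (p 0) else 0)" for n
  proof -
    have "(LINT t:{0..1}|lebesgue. cnj (PP t) * circle_char (- int n) t) = (LINT t:{0..1}|lebesgue. cnj (PP t * circle_char (int n) t))"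
      by (simp add: cis_cnj)
    also have "\<dots> = cnj (LINT t:{0..1}|lebesgue. PP t * circle_char (int n) t)"
      unfolding set_lebesgue_integral_def complex_cnj_scaleR[symmetric] by (rule Bochner_Integration.integral_cnj)
    finally show ?thesis by (subst (asm) coeff) auto
  qed
  have I1: "(\<lambda>n. b n * (p n * of_real \<rho> ^ n)) sums (LINT t:{0..1}|lebesgue. PP t * R t)"
  proof -
    have "(LINT t:{0..1}|lebesgue. PP t * circle_char (- int n) t) = p n * of_real \<rho> ^ n" for n
      by (subst coeff) simp
    with circle_mean_sums[OF cP bs, of "\<lambda>n. - int n"] show ?thesis by (simp only: Rs')
  qed
  have "(\<lambda>n. b n * (p n * of_real \<rho> ^ n)) sums (2 * S - d 0 * p 0)"
  proof -
    have "(\<lambda>n. 2 * (p n * d n * z ^ n) - (if n = 0 then d 0 * p 0 else 0)) sums (2 * S - d 0 * p 0)"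
      using sums_single[of 0 "\<lambda>_. d 0 * p 0"] by (intro sums_diff sums_mult S) simp
    moreover have "2 * (p n * d n * z ^ n) - (if n = 0 then d 0 * p 0 else 0) = b n * (p n * of_real \<rho> ^ n)" for n
      by (simp add: b_def z\<zeta> power_mult_distrib)
    ultimately show ?thesis by simp
  qed
  with I1 have J1: "(LINT t:{0..1}|lebesgue. PP t * R t) = 2 * S - d 0 * p 0" by (rule sums_unique2)
  have "(\<lambda>n. b n * (if n = 0 then cnj (p 0) else 0)) sums (LINT t:{0..1}|lebesgue. cnj (PP t) * R t)"
    using circle_mean_sums[OF continuous_on_cnj[OF cP] bs, of "\<lambda>n. - int n"] by (simp only: cnjcoeff Rs')
  moreover have "(\<lambda>n. b n * (if n = 0 then cnj (p 0) else 0)) sums (d 0 * cnj (p 0))"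
  proof -
    have "(\<lambda>n. b n * (if n = 0 then cnj (p 0) else 0)) = (\<lambda>n. if n = 0 then d 0 * cnj (p 0) else 0)" by (auto simp: b_def)
    then show ?thesis using sums_single[of 0 "\<lambda>_. d 0 * cnj (p 0)"] by simp
  qed
  ultimately have J2: "(LINT t:{0..1}|lebesgue. cnj (PP t) * R t) = d 0 * cnj (p 0)" by (rule sums_unique2)
  have "(\<lambda>n. b n * (if n = 0 then 1 else 0)) sums (LINT t:{0..1}|lebesgue. R t)"
  proof -
    have "(\<lambda>n. b n * (LINT t:{0..1}|lebesgue. 1 * circle_char (- int n) t)) sums (LINT t:{0..1}|lebesgue. 1 * R t)"
      using circle_mean_sums[OF continuous_on_const[of _ 1] bs, of "\<lambda>n. - int n"] by (simp only: Rs')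
    moreover have "(LINT t:{0..1}|lebesgue. 1 * circle_char (- int n) t) = (if n = 0 then 1 else 0)" for n
      unfolding mult_1 by (subst circle_char_integral) simp
    ultimately show ?thesis by (simp only: mult_1)
  qed
  moreover have "(\<lambda>n. b n * (if n = 0 then 1 else 0)) sums d 0"
  proof -
    have "(\<lambda>n. b n * (if n = 0 then 1 else 0)) = (\<lambda>n. if n = 0 then d 0 else 0)" by (auto simp: b_def)
    then show ?thesis using sums_single[of 0 "\<lambda>_. d 0"] by simp
  qed
  ultimately have J3: "(LINT t:{0..1}|lebesgue. R t) = d 0" by (rule sums_unique2)
  have iPR: "set_integrable lebesgue {0..1} (\<lambda>t. PP t * R t)" "set_integrable lebesgue {0..1} (\<lambda>t. cnj (PP t) * R t)"
     "set_integrable lebesgue {0..1} R"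
    by (intro absolutely_integrable_continuous_real continuous_intros cP cR)+
  have ReL: "Re (LINT t:{0..1}|lebesgue. h t) = (LINT t:{0..1}|lebesgue. Re (h t))" if "set_integrable lebesgue {0..1} h" for h
    using that unfolding set_lebesgue_integral_def set_integrable_def by (subst integral_Re[symmetric]) auto
  have "compact ((\<lambda>t. Re (PP t)) ` {0..1})" by (intro compact_continuous_image continuous_intros cP) auto
  then obtain t0 where t0: "t0 \<in> {0..1}" "\<And>t. t \<in> {0..1} \<Longrightarrow> Re (PP t0) \<le> Re (PP t)"
    using compact_attains_inf[of "(\<lambda>t. Re (PP t)) ` {0..1}"] by auto
  define \<delta> where "\<delta> = Re (PP t0)"
  have \<delta>: "0 < \<delta>" using ReP n\<rho> by (simp add: \<delta>_def PP_def)
  have Rn: "0 \<le> Re (R t)" for t using ReQ[OF n\<rho>(2)[of t]] by (simp add: R_def)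
  have "0 < 2 * \<delta> * Re (d 0)" using \<delta> d0 by simp
  also have "\<dots> = (LINT t:{0..1}|lebesgue. 2 * \<delta> * Re (R t))"
    using ReL[OF iPR(3)] by (simp add: J3)
  also have "\<dots> \<le> (LINT t:{0..1}|lebesgue. Re (PP t * R t + cnj (PP t) * R t))"
  proof (rule set_integral_mono)
    show "set_integrable lebesgue {0..1} (\<lambda>t. 2 * \<delta> * Re (R t))"
      "set_integrable lebesgue {0..1} (\<lambda>t. Re (PP t * R t + cnj (PP t) * R t))"
      by (intro absolutely_integrable_continuous_real continuous_intros cP cR)+
    fix t :: real assume t: "t \<in> {0..1}"
    have "PP t * R t + cnj (PP t) * R t = of_real (2 * Re (PP t)) * R t"
      by (metis complex_add_cnj distrib_right)
    then have "Re (PP t * R t + cnj (PP t) * R t) = 2 * Re (PP t) * Re (R t)" by simp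
    also have "\<dots> \<ge> 2 * \<delta> * Re (R t)"
      using t0(2)[OF t] Rn[of t] by (intro mult_right_mono) (auto simp: \<delta>_def)
    finally show "2 * \<delta> * Re (R t) \<le> Re (PP t * R t + cnj (PP t) * R t)" .
  qed
  also have "\<dots> = Re ((LINT t:{0..1}|lebesgue. PP t * R t) + (LINT t:{0..1}|lebesgue. cnj (PP t) * R t))"
    by (simp only: ReL[OF set_integral_add(1)[OF iPR(1,2)], symmetric] set_integral_add(2)[OF iPR(1,2)])
  also have "\<dots> = 2 * Re S"
  proof -
    obtain c where "d 0 = of_real c" using d0(1) by (auto elim: Reals_cases)
    then show ?thesis unfolding J1 J2 by simp
  qed
  finally show ?thesis by simp
qed

text \<open>The Taylor coefficients of \<open>starlike_kernel \<sigma> \<epsilon>\<close>.\<close>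

definition kernel_coeff :: "real \<Rightarrow> complex \<Rightarrow> nat \<Rightarrow> complex" where
  "kernel_coeff \<sigma> \<epsilon> m = (of_nat m * (1 + \<epsilon>) + of_real (2 - 2 * \<sigma>)) / of_real (2 - 2 * \<sigma>)"

lemma starlike_kernel_sums:
  assumes u: "norm u < 1"
  shows "(\<lambda>m. kernel_coeff \<sigma> \<epsilon> m * u ^ m) sums starlike_kernel \<sigma> \<epsilon> u"
proof -
  have g: "(\<lambda>m. u ^ m) sums (1 / (1 - u))" using u by (rule geometric_sums)
  have d: "(\<lambda>m. of_nat (Suc m) * u ^ m) sums (1 / (1 - u)\<^sup>2)" using u by (rule geometric_deriv_sums)
  have "(\<lambda>m. of_nat (Suc m) * u ^ m - u ^ m) sums (1 / (1 - u)\<^sup>2 - 1 / (1 - u))" by (rule sums_diff[OF d g])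
  moreover have "1 / (1 - u)\<^sup>2 - 1 / (1 - u) = u / (1 - u)\<^sup>2"
    using u by (auto simp: divide_simps power2_eq_square)
  ultimately have n: "(\<lambda>m. of_nat (Suc m) * u ^ m - u ^ m) sums (u / (1 - u)\<^sup>2)" by simp
  have "(\<lambda>m. (of_nat (Suc m) * u ^ m + of_real (1 - 2 * \<sigma>) * u ^ m + \<epsilon> * (of_nat (Suc m) * u ^ m - u ^ m)) / of_real (2 - 2 * \<sigma>))
     sums ((1 / (1 - u)\<^sup>2 + of_real (1 - 2 * \<sigma>) * (1 / (1 - u)) + \<epsilon> * (u / (1 - u)\<^sup>2)) / of_real (2 - 2 * \<sigma>))"
    by (intro sums_divide sums_add sums_mult g d n)
  moreover have "(of_nat (Suc m) * u ^ m + of_real (1 - 2 * \<sigma>) * u ^ m + \<epsilon> * (of_nat (Suc m) * u ^ m - u ^ m)) / of_real (2 - 2 * \<sigma>)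
      = kernel_coeff \<sigma> \<epsilon> m * u ^ m" for m
    unfolding kernel_coeff_def times_divide_eq_left
    by (rule arg_cong[where f = "\<lambda>x. x / _"]) (simp add: algebra_simps)
  ultimately show ?thesis by (simp add: starlike_kernel_def)
qed

lemma integral_moment:
  fixes W :: "real \<Rightarrow> real" and c :: complex
  assumes "set_integrable lebesgue {0..1} W"
  shows "(LINT t:{0..1}|lebesgue. W t *\<^sub>R (c * of_real t ^ m)) = c * of_real (LINT t:{0..1}|lebesgue. W t * t ^ m)"
proof -
  have "W t *\<^sub>R (c * of_real t ^ m) = c * of_real (W t * t ^ m)" for t
    by (simp add: scaleR_conv_of_real)
  then show ?thesis by (simp only: set_integral_mult_right set_integral_complex_of_real)
qed

lemma integral_power_series_sums:
  fixes c :: "nat \<Rightarrow> complex"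
  assumes W: "set_integrable lebesgue {0..1} W"
    and f: "\<And>z. norm z < 1 \<Longrightarrow> (\<lambda>n. c n * z ^ n) sums f z" and z: "norm z < 1"
  shows "(\<lambda>n. of_real (LINT t:{0..1}|lebesgue. W t * t ^ n) * c n * z ^ n) sums
     (LINT t:{0..1}|lebesgue. W t *\<^sub>R f (of_real t * z))"
proof -
  have tz: "norm (of_real t * z) < 1" if "t \<in> {0..1}" for t
    using that z mult_left_le_one_le[of "norm z" t] by (auto simp: norm_mult)
  have "(\<lambda>n. LINT t:{0..1}|lebesgue. W t *\<^sub>R (c n * z ^ n * of_real t ^ n)) sums
     (LINT t:{0..1}|lebesgue. W t *\<^sub>R (\<Sum>n. c n * z ^ n * of_real t ^ n))"
  proof (rule integral_dominated_sums[OF W])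
    show "continuous_on {0..1} (\<lambda>t. c n * z ^ n * of_real t ^ n)" for n by (intro continuous_intros)
    show "summable (\<lambda>n. norm (c n * z ^ n))" using f z by (rule power_series_on_disc(4))
    show "norm (c n * z ^ n * of_real t ^ n) \<le> norm (c n * z ^ n)" if "t \<in> {0..1}" for n t
      using that by (simp add: norm_mult norm_power mult_left_le power_le_one)
  qed
  moreover have "(LINT t:{0..1}|lebesgue. W t *\<^sub>R (\<Sum>n. c n * z ^ n * of_real t ^ n)) = (LINT t:{0..1}|lebesgue. W t *\<^sub>R f (of_real t * z))"
  proof (intro set_lebesgue_integral_cong allI impI)
    fix t :: real assume t: "t \<in> {0..1}"
    have "(\<Sum>n. c n * z ^ n * of_real t ^ n) = f (of_real t * z)"
      using sums_unique[OF f[OF tz[OF t]]] by (simp add: power_mult_distrib mult_ac)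
    then show "W t *\<^sub>R (\<Sum>n. c n * z ^ n * of_real t ^ n) = W t *\<^sub>R f (of_real t * z)" by simp
  qed simp
  ultimately show ?thesis unfolding integral_moment[OF W] by (simp add: mult_ac)
qed

section \<open>The Pascu class by nonvanishing\<close>

text \<open>Here \<open>k(z) = K(z)/z\<close> for \<open>K = \<xi> z F' + (1 - \<xi>) F\<close>, and the expression assumed to be nonzero is the
  Hadamard product \<open>(K * h\<^sub>\<epsilon>)(z)/z\<close>. For \<open>\<epsilon> = -1\<close> it is \<open>k(z)\<close> itself. If \<open>w = z K'/K\<close> had real part \<open>\<sigma>\<close>
  at some point, then \<open>1 + \<epsilon> = -(2 - 2\<sigma>)/(w - 1)\<close> would define a unimodular \<open>\<epsilon>\<close> for which
  the expression is zero.\<close>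

lemma pascu_class_of_nonvanishing:
  assumes \<sigma>: "\<sigma> < 1" and F: "\<And>z. norm z < 1 \<Longrightarrow> F z = z * v z"
    and v: "v holomorphic_on ball 0 1" "v 0 = 1"
    and k: "\<And>z. norm z < 1 \<Longrightarrow> k z = v z + of_real \<xi> * (z * deriv v z)"
    and nz: "\<And>z \<epsilon>. norm z < 1 \<Longrightarrow> norm \<epsilon> = 1 \<Longrightarrow> k z + (1 + \<epsilon>) / of_real (2 - 2 * \<sigma>) * (z * deriv k z) \<noteq> 0"
  shows "F \<in> pascu_class \<sigma> \<xi>"
proof -
  have dv: "(v has_field_derivative deriv v z) (at z)" if "norm z < 1" for z
    using v that by (intro holomorphic_derivI[of v "ball 0 1"]) auto
  have hdv: "deriv v holomorphic_on ball 0 1" using v by (intro holomorphic_deriv) auto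
  have hk: "k holomorphic_on ball 0 1"
    by (rule holomorphic_transform[where f = "\<lambda>z. v z + of_real \<xi> * (z * deriv v z)"])
       (use k v hdv in \<open>auto intro!: holomorphic_intros\<close>)
  have dk: "(k has_field_derivative deriv k z) (at z)" if "norm z < 1" for z
    using hk that by (intro holomorphic_derivI[of k "ball 0 1"]) auto
  have hF: "F holomorphic_on ball 0 1"
    by (rule holomorphic_transform[where f = "\<lambda>z. z * v z"]) (use F v in \<open>auto intro!: holomorphic_intros\<close>)
  have dF: "deriv F z = v z + z * deriv v z" if z: "norm z < 1" for z
  proof (rule DERIV_imp_deriv, rule has_field_derivative_transform_within_open[where S = "ball 0 1" and f = "\<lambda>z. z * v z"])
    show "((\<lambda>z. z * v z) has_field_derivative v z + z * deriv v z) (at z)"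
      using dv[OF z] by (auto intro!: derivative_eq_intros)
  qed (use F z in auto)
  have A: "F \<in> class_A" using hF F[of 0] dF[of 0] v by (simp add: class_A_def)
  have K: "of_real \<xi> * z * deriv F z + of_real (1 - \<xi>) * F z = z * k z" if z: "norm z < 1" for z
    unfolding dF[OF z] F[OF z] k[OF z] by (simp add: algebra_simps)
  have hdF: "(\<lambda>w. w * deriv F w) holomorphic_on ball 0 1" using hF by (intro holomorphic_intros holomorphic_deriv) auto
  have dK: "of_real \<xi> * z * deriv (\<lambda>w. w * deriv F w) z + of_real (1 - \<xi>) * z * deriv F z = z * (k z + z * deriv k z)"
    if z: "norm z < 1" for z
  proof -
    have d1: "((\<lambda>w. w * deriv F w) has_field_derivative deriv (\<lambda>w. w * deriv F w) z) (at z)"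
      using hdF z by (intro holomorphic_derivI[of _ "ball 0 1"]) auto
    have d2: "(F has_field_derivative deriv F z) (at z)"
      using hF z by (intro holomorphic_derivI[of _ "ball 0 1"]) auto
    have e1: "((\<lambda>w. of_real \<xi> * (w * deriv F w) + of_real (1 - \<xi>) * F w) has_field_derivative
        of_real \<xi> * deriv (\<lambda>w. w * deriv F w) z + of_real (1 - \<xi>) * deriv F z) (at z)"
      by (intro DERIV_add DERIV_cmult d1 d2)
    have "((\<lambda>w. w * k w) has_field_derivative k z + z * deriv k z) (at z)"
      using dk[OF z] by (auto intro!: derivative_eq_intros)
    then have "((\<lambda>w. of_real \<xi> * (w * deriv F w) + of_real (1 - \<xi>) * F w) has_field_derivative k z + z * deriv k z) (at z)"
      by (rule has_field_derivative_transform_within_open[where S = "ball 0 1"]) (use z K in \<open>auto simp: mult.assoc\<close>)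
    from DERIV_unique[OF e1 this] have "z * (of_real \<xi> * deriv (\<lambda>w. w * deriv F w) z + of_real (1 - \<xi>) * deriv F z) = z * (k z + z * deriv k z)"
      by simp
    then show ?thesis by (simp add: algebra_simps)
  qed
  have k0: "k z \<noteq> 0" if "norm z < 1" for z using nz[OF that, of "-1"] by simp
  define w where "w = (\<lambda>z. 1 + z * deriv k z / k z)"
  have wne: "Re (w z) \<noteq> \<sigma>" if z: "norm z < 1" for z
  proof
    assume eq: "Re (w z) = \<sigma>"
    define a where "a = w z - 1"
    define c where "c = complex_of_real (2 - 2 * \<sigma>)"
    define \<epsilon> where "\<epsilon> = - (c / a) - 1"
    have ra: "Re a = \<sigma> - 1" using eq by (simp add: a_def)
    then have a0: "a \<noteq> 0" using \<sigma> by auto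
    have "a * \<epsilon> = - c - a" using a0 by (simp add: \<epsilon>_def right_diff_distrib)
    also have "\<dots> = cnj a" using ra by (simp add: c_def complex_eq_iff)
    finally have "norm a * norm \<epsilon> = norm a" by (metis complex_mod_cnj norm_mult)
    then have "norm \<epsilon> = 1" using a0 by simp
    from nz[OF z this] show False
    proof (rule notE)
      have "z * deriv k z = a * k z" using k0[OF z] by (simp add: a_def w_def)
      moreover have "(1 + \<epsilon>) / of_real (2 - 2 * \<sigma>) = - 1 / a" using \<sigma> by (auto simp: \<epsilon>_def c_def simp flip: of_real_eq_iff)
      ultimately show "k z + (1 + \<epsilon>) / of_real (2 - 2 * \<sigma>) * (z * deriv k z) = 0" using a0 by simp
    qed
  qed
  have cw: "continuous_on (ball 0 1) (\<lambda>z. Re (w z))"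
    unfolding w_def using k0 hk
    by (intro continuous_intros holomorphic_on_imp_continuous_on holomorphic_deriv) auto
  have wgt: "\<sigma> < Re (w z)" if z: "norm z < 1" for z
  proof (rule ccontr)
    assume "\<not> \<sigma> < Re (w z)"
    then have "Re (w z) \<le> \<sigma>" "\<sigma> \<le> Re (w 0)" using \<sigma> by (auto simp: w_def)
    moreover have "connected ((\<lambda>z. Re (w z)) ` ball 0 1)"
      by (rule connected_continuous_image[OF cw]) simp
    ultimately have "\<sigma> \<in> (\<lambda>z. Re (w z)) ` ball 0 1"
      using z unfolding connected_iff_interval by (metis (no_types, lifting) centre_in_ball dist_0_norm imageI mem_ball zero_less_one)
    then obtain z' where "norm z' < 1" "Re (w z') = \<sigma>" by auto
    with wne show False by blast
  qed
  show ?thesis unfolding pascu_class_def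
  proof (intro CollectI conjI A ballI)
    fix z :: complex assume "z \<in> ball 0 1 - {0}"
    then have z: "norm z < 1" "z \<noteq> 0" by auto
    show "of_real \<xi> * z * deriv F z + of_real (1 - \<xi>) * F z \<noteq> 0" using K[OF z(1)] k0[OF z(1)] z by simp
    have "z * (k z + z * deriv k z) / (z * k z) = w z"
      using z k0[OF z(1)] by (simp add: w_def add_divide_distrib)
    then show "\<sigma> < Re ((of_real \<xi> * z * deriv (\<lambda>w. w * deriv F w) z + of_real (1 - \<xi>) * z * deriv F z) /
         (of_real \<xi> * z * deriv F z + of_real (1 - \<xi>) * F z))"
      unfolding K[OF z(1)] dK[OF z(1)] using wgt[OF z(1)] by simp
  qed
qed

section \<open>Coefficients of the class W and of its image\<close>

lemma class_A_power_series:
  assumes f: "f \<in> class_A"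
  obtains A where "A 0 = 1" "\<And>z. norm z < 1 \<Longrightarrow> (\<lambda>n. A n * z ^ n) sums div_z f z"
    "\<And>z. norm z < 1 \<Longrightarrow> (\<lambda>n. of_nat (Suc n) * A n * z ^ n) sums deriv f z"
    "\<And>z. norm z < 1 \<Longrightarrow> (\<lambda>n. of_nat n * (of_nat (Suc n) * A n) * z ^ n) sums (z * (deriv ^^ 2) f z)"
proof -
  have hf: "f holomorphic_on ball 0 1" and f0: "f 0 = 0" and f1: "deriv f 0 = 1" using f by (auto simp: class_A_def)
  define a where "a = (\<lambda>n. (deriv ^^ n) f 0 / fact n)"
  have fs: "(\<lambda>n. a n * z ^ n) sums f z" if "norm z < 1" for z
    using holomorphic_power_series[OF hf, of z] that by (simp add: a_def)
  have a0: "a 0 = 0" and a1: "a 1 = 1" using f0 f1 by (auto simp: a_def)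
  define A where "A = (\<lambda>n. a (Suc n))"
  have d1: "(\<lambda>n. of_nat (Suc n) * A n * z ^ n) sums deriv f z" if "norm z < 1" for z
    unfolding A_def using fs that by (rule power_series_on_disc(2))
  show ?thesis
  proof (rule that[of A])
    show "A 0 = 1" using a1 by (simp add: A_def)
    show "(\<lambda>n. A n * z ^ n) sums div_z f z" if z: "norm z < 1" for z
    proof (cases "z = 0")
      case True
      then show ?thesis using powser_sums_zero[of A] a1 f1 by (simp add: div_z_def A_def)
    next
      case False
      have "(\<lambda>n. a (Suc n) * z ^ Suc n) sums f z" using fs[OF z] a0 by (subst sums_Suc_iff) simp
      then have "(\<lambda>n. a (Suc n) * z ^ Suc n / z) sums (f z / z)" by (rule sums_divide)
      then show ?thesis using False by (simp add: A_def div_z_def)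
    qed
    show "(\<lambda>n. of_nat (Suc n) * A n * z ^ n) sums deriv f z" if "norm z < 1" for z by (rule d1[OF that])
    show "(\<lambda>n. of_nat n * (of_nat (Suc n) * A n) * z ^ n) sums (z * (deriv ^^ 2) f z)" if "norm z < 1" for z
    proof -
      have "(\<lambda>n. of_nat n * (of_nat (Suc n) * A n) * z ^ n) sums (z * deriv (deriv f) z)"
        using d1 that by (rule power_series_on_disc(3))
      then show ?thesis by (simp add: numeral_2_eq_2)
    qed
  qed
qed

text \<open>The integrands agree except at \<open>t = 0\<close>, where the quotient \<open>f(tz)/t\<close> is \<open>0\<close> by convention.\<close>

lemma V_transform_eq:
  assumes lam: "set_integrable lebesgue {0..1} lam" and f: "f \<in> class_A" and z: "norm z < 1"
  shows "V_transform lam f z = z * (LINT t:{0..1}|lebesgue. lam t *\<^sub>R div_z f (of_real t * z))"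
proof -
  obtain A where A: "\<And>z. norm z < 1 \<Longrightarrow> (\<lambda>n. A n * z ^ n) sums div_z f z"
    using class_A_power_series[OF f] by metis
  have hol: "div_z f holomorphic_on ball 0 1" using A by (rule power_series_on_disc(1))
  have "(\<lambda>t. of_real t * z) ` {0..1} \<subseteq> ball 0 1"
    using z mult_left_le_one_le[of "norm z"] by (fastforce simp: norm_mult)
  then have c: "continuous_on {0..1} (\<lambda>t. z * div_z f (of_real t * z))"
    by (intro continuous_intros continuous_on_compose2[OF holomorphic_on_imp_continuous_on[OF hol]])
  define h where "h = (\<lambda>t. indicator {0..1} t *\<^sub>R (lam t *\<^sub>R (z * div_z f (of_real t * z))))"
  have h: "h \<in> borel_measurable lebesgue"
    using set_integrable_mult_continuous[OF lam c] unfolding h_def set_integrable_def by (rule borel_measurable_integrable)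
  define h' where "h' = (\<lambda>t. indicator {0..1} t *\<^sub>R (of_real (lam t) * (f (of_real t * z) / of_real t)))"
  have eq: "h' t = (if t = 0 then 0 else h t)" for t
    using f by (cases "z = 0") (auto simp: h'_def h_def div_z_def class_A_def scaleR_conv_of_real)
  have h': "h' \<in> borel_measurable lebesgue"
    unfolding eq[abs_def] using h by (intro measurable_If) (auto intro!: measurable_completion)
  have "V_transform lam f z = (LINT t|lebesgue. h' t)"
    by (simp add: V_transform_def set_lebesgue_integral_def h'_def)
  also have "\<dots> = (LINT t|lebesgue. h t)"
  proof (rule integral_cong_AE[OF h' h])
    show "AE t in lebesgue. h' t = h t" using AE_lebesgue_neq_0_1 by eventually_elim (simp add: eq)
  qed
  also have "\<dots> = (LINT t:{0..1}|lebesgue. z * (lam t *\<^sub>R div_z f (of_real t * z)))"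
    by (simp add: set_lebesgue_integral_def h_def)
  finally show ?thesis by (simp only: set_integral_mult_right)
qed

text \<open>With \<open>\<alpha> = \<mu> + \<nu> + \<mu>\<nu>\<close> and \<open>\<gamma> = \<mu>\<nu>\<close> the three terms in the definition of the class combine to the
  multiplier \<open>1 + n(\<mu> + \<nu>) + n\<^sup>2 \<mu>\<nu>\<close> of the coefficient of \<open>z\<^sup>n\<close> in \<open>f(z)/z\<close>.\<close>

lemma class_W_hadamard_representation:
  assumes f: "f \<in> class_W \<beta> \<alpha> \<gamma>" and par: "\<mu> + \<nu> = \<alpha> - \<gamma>" "\<mu> * \<nu> = \<gamma>"
  obtains A \<phi> P where "f \<in> class_A" "A 0 = 1"
    "\<And>z. norm z < 1 \<Longrightarrow> (\<lambda>n. A n * z ^ n) sums div_z f z"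
    "\<And>z. norm z < 1 \<Longrightarrow> (\<lambda>n. exp (\<i> * of_real \<phi>) * (of_real ((1 + \<mu> * real n) * (1 + \<nu> * real n)) * A n
        - (if n = 0 then of_real \<beta> else 0)) * z ^ n) sums P z"
    "\<And>z. norm z < 1 \<Longrightarrow> 0 < Re (P z)"
proof -
  obtain \<phi> where \<phi>': "\<forall>z\<in>ball 0 1. 0 < Re (exp (\<i> * of_real \<phi>) *
       (of_real (1 - \<alpha> + 2 * \<gamma>) * div_z f z + of_real (\<alpha> - 2 * \<gamma>) * deriv f z
        + of_real \<gamma> * z * (deriv ^^ 2) f z - of_real \<beta>))" and fA: "f \<in> class_A"
    using f unfolding class_W_def by blast
  then have \<phi>: "0 < Re (exp (\<i> * of_real \<phi>) *
       (of_real (1 - \<alpha> + 2 * \<gamma>) * div_z f z + of_real (\<alpha> - 2 * \<gamma>) * deriv f z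
        + of_real \<gamma> * z * (deriv ^^ 2) f z - of_real \<beta>))" if "norm z < 1" for z
    using that by (simp only: mem_ball dist_0_norm)
  from fA obtain A where A: "A 0 = 1" "\<And>z. norm z < 1 \<Longrightarrow> (\<lambda>n. A n * z ^ n) sums div_z f z"
    "\<And>z. norm z < 1 \<Longrightarrow> (\<lambda>n. of_nat (Suc n) * A n * z ^ n) sums deriv f z"
    "\<And>z. norm z < 1 \<Longrightarrow> (\<lambda>n. of_nat n * (of_nat (Suc n) * A n) * z ^ n) sums (z * (deriv ^^ 2) f z)"
    using class_A_power_series by blast
  have coeff: "(1 - \<alpha> + 2 * \<gamma>) + (\<alpha> - 2 * \<gamma>) * (1 + x) + \<gamma> * (x * (1 + x)) = (1 + \<mu> * x) * (1 + \<nu> * x)" for x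
  proof -
    have "\<alpha> = \<mu> + \<nu> + \<gamma>" using par by simp
    then show ?thesis by (simp add: par(2)[symmetric] algebra_simps)
  qed
  show ?thesis
  proof (rule that[OF fA A(1,2)])
    fix z :: complex assume z: "norm z < 1"
    have "(\<lambda>n. if n = 0 then complex_of_real \<beta> else 0) sums of_real \<beta>"
      using sums_single[of 0 "\<lambda>_. complex_of_real \<beta>"] by simp
    then have "(\<lambda>n. exp (\<i> * of_real \<phi>) * (of_real (1 - \<alpha> + 2 * \<gamma>) * (A n * z ^ n) + of_real (\<alpha> - 2 * \<gamma>) * (of_nat (Suc n) * A n * z ^ n)
         + of_real \<gamma> * (of_nat n * (of_nat (Suc n) * A n) * z ^ n) - (if n = 0 then of_real \<beta> else 0))) sums
       (exp (\<i> * of_real \<phi>) * (of_real (1 - \<alpha> + 2 * \<gamma>) * div_z f z + of_real (\<alpha> - 2 * \<gamma>) * deriv f z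
        + of_real \<gamma> * (z * (deriv ^^ 2) f z) - of_real \<beta>))"
      by (intro sums_mult sums_add sums_diff A(2-)[OF z])
    moreover have "of_real (1 - \<alpha> + 2 * \<gamma>) * (A n * z ^ n) + of_real (\<alpha> - 2 * \<gamma>) * (of_nat (Suc n) * A n * z ^ n)
         + of_real \<gamma> * (of_nat n * (of_nat (Suc n) * A n) * z ^ n) - (if n = 0 then of_real \<beta> else 0)
       = (of_real ((1 + \<mu> * real n) * (1 + \<nu> * real n)) * A n - (if n = 0 then of_real \<beta> else 0)) * z ^ n" for n
      unfolding coeff[symmetric] by (simp add: algebra_simps)
    ultimately show "(\<lambda>n. exp (\<i> * of_real \<phi>) * (of_real ((1 + \<mu> * real n) * (1 + \<nu> * real n)) * A n
        - (if n = 0 then of_real \<beta> else 0)) * z ^ n) sums (exp (\<i> * of_real \<phi>) * (of_real (1 - \<alpha> + 2 * \<gamma>) * div_z f z + of_real (\<alpha> - 2 * \<gamma>) * deriv f z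
        + of_real \<gamma> * z * (deriv ^^ 2) f z - of_real \<beta>))"
      by (simp only: mult.assoc)
    show "0 < Re (exp (\<i> * of_real \<phi>) * (of_real (1 - \<alpha> + 2 * \<gamma>) * div_z f z + of_real (\<alpha> - 2 * \<gamma>) * deriv f z
        + of_real \<gamma> * z * (deriv ^^ 2) f z - of_real \<beta>))" by (rule \<phi>[OF z])
  qed
qed

section \<open>The inclusion\<close>

theorem theorem3p2:
  fixes \<sigma> \<xi> \<alpha> \<beta> \<gamma> \<mu> \<nu> :: real and lam :: "real \<Rightarrow> real"
  assumes "0 \<le> \<sigma>" and "\<sigma> \<le> 1 / 2"
    and "0 \<le> \<xi>" and "\<xi> \<le> 1"
    and "\<alpha> \<ge> 0" and "\<gamma> > 0"
    and "\<mu> \<ge> 1" and "\<nu> > 0"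
    and "\<mu> + \<nu> = \<alpha> - \<gamma>" and "\<mu> * \<nu> = \<gamma>"
    and "\<And>t. t \<in> {0..1} \<Longrightarrow> lam t \<ge> 0"
    and "set_integrable lebesgue {0..1} lam"
    and "(LINT t:{0..1}|lebesgue. lam t) = 1"
    and "set_integrable lebesgue {0..1} (Lambda_fun lam \<nu>)"
    and "set_integrable lebesgue {0..1} (Pi_fun lam \<mu> \<nu>)"
    and "\<And>t. t \<in> {0<..<1} \<Longrightarrow> Lambda_fun lam \<nu> t > 0"
    and "\<And>t. t \<in> {0<..<1} \<Longrightarrow> Pi_fun lam \<mu> \<nu> t > 0"
    and "\<beta> < 1"
    and "\<beta> / (1 - \<beta>) =
      - (LINT t:{0..1}|lebesgue.
           lam t * ((1 - \<xi>) * g_fun \<sigma> \<mu> \<nu> t + \<xi> * (2 * q_fun \<sigma> \<mu> \<nu> t - 1)))"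
    and "mono_on {0<..<1} (\<lambda>t. Pi_numerator lam \<mu> \<nu> \<xi> t / ln (1 / t) powr (1 + 2 * \<sigma>))"
  shows "V_transform lam ` class_W \<beta> \<alpha> \<gamma> \<subseteq> pascu_class \<sigma> \<xi>"
proof (intro subsetI, elim imageE, simp only:)
  fix f assume fW: "f \<in> class_W \<beta> \<alpha> \<gamma>"
  note \<sigma> = assms(1,2) and \<xi> = assms(3,4) and lam = assms(12) and lam1 = assms(13)
  have \<mu>: "0 < \<mu>" "1 \<le> \<mu>" and \<nu>: "0 < \<nu>" and \<sigma>1: "\<sigma> < 1" using assms by auto
  define W where "W = pascu_weight lam \<mu> \<nu> \<xi>"
  have iW: "set_integrable lebesgue {0..1} W" unfolding W_def by (rule pascu_weight_integrable[OF lam \<mu>(1) \<nu>])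
  define M where "M = (\<lambda>n. (LINT t:{0..1}|lebesgue. lam t * t ^ n))"
  have M0: "M 0 = 1" using lam1 by (simp add: M_def)
  define \<kappa> where "\<kappa> = (\<lambda>n. (LINT t:{0..1}|lebesgue. W t * t ^ n) / (\<mu> * \<nu>))"
  have \<kappa>: "(1 + \<mu> * real n) * (1 + \<nu> * real n) * \<kappa> n = (1 + \<xi> * real n) * M n" for n
  proof -
    have "1 + \<mu> * real n > 0" "1 + \<nu> * real n > 0" using \<mu> \<nu> by (auto intro: add_pos_nonneg)
    then show ?thesis unfolding \<kappa>_def W_def pascu_weight_moment[OF lam \<mu>(1) \<nu>] M_def using \<mu> \<nu> by simp
  qed
  have \<kappa>0: "\<kappa> 0 = 1" using \<kappa>[of 0] M0 by simp
  define b where "b = \<beta> / (1 - \<beta>)"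
  have b1: "1 + b = 1 / (1 - \<beta>)" using \<open>\<beta> < 1\<close> by (simp add: b_def field_simps)
  have base: "2 / (\<mu> * \<nu>) * (LINT t:{0..1}|lebesgue. W t * starlike_bound \<sigma> t) = 1 - b"
    using assms(19) integral_pascu_weight_starlike_bound[OF lam \<mu>(1) \<nu> \<sigma>1 lam1, of \<xi>] by (simp add: b_def W_def)
  obtain k where k: "\<And>t. 0 < t \<Longrightarrow> t < 1 \<Longrightarrow> W t = k t * ln (1 / t)"
    "\<And>t. 0 < t \<Longrightarrow> t < 1 \<Longrightarrow> 0 \<le> k t"
    "\<And>s t. 0 < s \<Longrightarrow> s \<le> t \<Longrightarrow> t < 1 \<Longrightarrow> k t \<le> k s"
    using pascu_weight_factorization[OF \<sigma>(1) \<mu>(2) \<nu> \<xi> lam assms(16,17,20)] unfolding W_def by metis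
  obtain A \<phi> P where fA: "f \<in> class_A" and A0: "A 0 = 1"
    and As: "\<And>z. norm z < 1 \<Longrightarrow> (\<lambda>n. A n * z ^ n) sums div_z f z"
    and Ps: "\<And>z. norm z < 1 \<Longrightarrow> (\<lambda>n. exp (\<i> * of_real \<phi>) * (of_real ((1 + \<mu> * real n) * (1 + \<nu> * real n)) * A n
        - (if n = 0 then of_real \<beta> else 0)) * z ^ n) sums P z"
    and ReP: "\<And>z. norm z < 1 \<Longrightarrow> 0 < Re (P z)"
    using class_W_hadamard_representation[OF fW assms(9,10)] by blast
  define v where "v = (\<lambda>z. LINT t:{0..1}|lebesgue. lam t *\<^sub>R div_z f (of_real t * z))"
  have vs: "(\<lambda>n. of_real (M n) * A n * z ^ n) sums v z" if "norm z < 1" for z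
    unfolding v_def M_def using lam As that by (rule integral_power_series_sums)
  define kk where "kk = (\<lambda>z. v z + of_real \<xi> * (z * deriv v z))"
  \<comment> \<open>The coefficients of \<open>K(z)/z\<close> with \<open>K = \<xi> z F' + (1 - \<xi>) F\<close>.\<close>
  define C where "C = (\<lambda>n. of_real ((1 + \<xi> * real n) * M n) * A n)"
  have ks: "(\<lambda>n. C n * z ^ n) sums kk z" if z: "norm z < 1" for z
  proof -
    have "(\<lambda>n. of_nat n * (of_real (M n) * A n) * z ^ n) sums (z * deriv v z)"
      using vs z by (rule power_series_on_disc(3))
    from sums_add[OF vs[OF z] sums_mult[OF this, of "of_real \<xi>"]]
    show ?thesis unfolding kk_def C_def by (simp add: algebra_simps)
  qed
  show "V_transform lam f \<in> pascu_class \<sigma> \<xi>"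
  proof (rule pascu_class_of_nonvanishing[OF \<sigma>1])
    show "V_transform lam f z = z * v z" if "norm z < 1" for z
      unfolding v_def by (rule V_transform_eq[OF lam fA that])
    show "v holomorphic_on ball 0 1" using vs by (rule power_series_on_disc(1))
    have "v 0 = of_real (M 0) * A 0" using vs by (rule power_series_on_disc(5))
    then show "v 0 = 1" by (simp add: M0 A0)
    show "kk z = v z + of_real \<xi> * (z * deriv v z)" for z by (simp add: kk_def)
  next
    fix z \<epsilon> :: complex assume z: "norm z < 1" and \<epsilon>: "norm \<epsilon> = 1"
    define S where "S = (\<lambda>u. LINT t:{0..1}|lebesgue. W t *\<^sub>R starlike_kernel \<sigma> \<epsilon> (of_real t * u))"
    define Q where "Q = (\<lambda>u. of_real (1 / (\<mu> * \<nu>)) * S u + of_real b)"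
    \<comment> \<open>The constant \<open>b = \<beta>/(1-\<beta>)\<close> compensates for the \<open>\<beta>\<close> subtracted from the constant coefficient of \<open>P\<close>.\<close>
    define d where "d = (\<lambda>n. of_real (\<kappa> n) * kernel_coeff \<sigma> \<epsilon> n + (if n = 0 then of_real b else 0))"
    have c0: "kernel_coeff \<sigma> \<epsilon> 0 = 1" using \<sigma>1 by (simp add: kernel_coeff_def)
    have Qs: "(\<lambda>n. d n * u ^ n) sums Q u" if u: "norm u < 1" for u
    proof -
      have "(\<lambda>n. of_real (LINT t:{0..1}|lebesgue. W t * t ^ n) * kernel_coeff \<sigma> \<epsilon> n * u ^ n) sums S u"
        unfolding S_def using iW starlike_kernel_sums u by (rule integral_power_series_sums)
      from sums_mult[OF this, of "of_real (1 / (\<mu> * \<nu>))"]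
      have 1: "(\<lambda>n. of_real (1 / (\<mu> * \<nu>)) * (of_real (LINT t:{0..1}|lebesgue. W t * t ^ n) * kernel_coeff \<sigma> \<epsilon> n * u ^ n)) sums (of_real (1 / (\<mu> * \<nu>)) * S u)" .
      have 2: "(\<lambda>n. if n = 0 then complex_of_real b else 0) sums of_real b"
        using sums_single[of 0 "\<lambda>_. complex_of_real b"] by simp
      have "of_real (1 / (\<mu> * \<nu>)) * (of_real (LINT t:{0..1}|lebesgue. W t * t ^ n) * kernel_coeff \<sigma> \<epsilon> n * u ^ n) + (if n = 0 then complex_of_real b else 0) = d n * u ^ n" for n
        by (simp add: d_def \<kappa>_def algebra_simps)
      with sums_add[OF 1 2] show ?thesis by (simp add: Q_def)
    qed
    have d0: "d 0 = of_real (1 / (1 - \<beta>))" by (simp add: d_def \<kappa>0 c0 b1[symmetric])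
    have ReQ: "Re (d 0) / 2 \<le> Re (Q u)" if u: "norm u < 1" for u
    proof -
      have i: "set_integrable lebesgue {0..1} (\<lambda>t. W t *\<^sub>R starlike_kernel \<sigma> \<epsilon> (of_real t * u))"
        by (rule set_integrable_mult_continuous[OF iW starlike_kernel_continuous[OF u \<sigma>1]])
      have "Re (S u) = (LINT t:{0..1}|lebesgue. W t * Re (starlike_kernel \<sigma> \<epsilon> (of_real t * u)))"
        using i unfolding S_def set_lebesgue_integral_def set_integrable_def
        by (subst integral_Re[symmetric]) (auto simp: mult.assoc)
      then have "(LINT t:{0..1}|lebesgue. W t * starlike_bound \<sigma> t) \<le> Re (S u)"
        using integral_starlike_kernel_ge[OF \<sigma> u \<epsilon> iW k] by simp
      then have "1 / (\<mu> * \<nu>) * (LINT t:{0..1}|lebesgue. W t * starlike_bound \<sigma> t) \<le> 1 / (\<mu> * \<nu>) * Re (S u)"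
        using \<mu> \<nu> by (intro mult_left_mono) auto
      moreover have "Re (Q u) = 1 / (\<mu> * \<nu>) * Re (S u) + b" unfolding Q_def by simp
      moreover have "Re (d 0) = 1 + b" by (simp add: d0 b1)
      moreover have "2 * (1 / (\<mu> * \<nu>) * (LINT t:{0..1}|lebesgue. W t * starlike_bound \<sigma> t)) = 1 - b"
        using base by simp
      ultimately show ?thesis by linarith
    qed
    define T where "T = kk z + (1 + \<epsilon>) / of_real (2 - 2 * \<sigma>) * (z * deriv kk z)"
    have Ts: "(\<lambda>n. kernel_coeff \<sigma> \<epsilon> n * C n * z ^ n) sums T"
    proof -
      have "(\<lambda>n. of_nat n * C n * z ^ n) sums (z * deriv kk z)" using ks z by (rule power_series_on_disc(3))
      from sums_add[OF ks[OF z] sums_mult[OF this, of "(1 + \<epsilon>) / of_real (2 - 2 * \<sigma>)"]]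
      have "(\<lambda>n. C n * z ^ n + (1 + \<epsilon>) / of_real (2 - 2 * \<sigma>) * (of_nat n * C n * z ^ n)) sums T" by (simp only: T_def)
      moreover have "C n * z ^ n + (1 + \<epsilon>) / of_real (2 - 2 * \<sigma>) * (of_nat n * C n * z ^ n) = kernel_coeff \<sigma> \<epsilon> n * C n * z ^ n" for n
      proof -
        define q where "q = complex_of_real (2 - 2 * \<sigma>)"
        have "q \<noteq> 0" using \<sigma>1 unfolding q_def of_real_eq_0_iff by simp
        then have "kernel_coeff \<sigma> \<epsilon> n = 1 + (1 + \<epsilon>) / of_real (2 - 2 * \<sigma>) * of_nat n"
          unfolding kernel_coeff_def q_def[symmetric] by (simp add: field_simps)
        then show ?thesis by (simp only: distrib_right mult_1 mult.assoc)
      qed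
      ultimately show ?thesis by simp
    qed
    have "0 < Re (exp (\<i> * of_real \<phi>) * T)"
    proof (rule hadamard_product_real_part_pos[OF Ps Qs ReP ReQ _ _ z])
      show "d 0 \<in> \<real>" "0 < Re (d 0)" using \<open>\<beta> < 1\<close> unfolding d0 by auto
      have "exp (\<i> * of_real \<phi>) * (of_real ((1 + \<mu> * real n) * (1 + \<nu> * real n)) * A n - (if n = 0 then of_real \<beta> else 0)) * d n * z ^ n
         = exp (\<i> * of_real \<phi>) * (kernel_coeff \<sigma> \<epsilon> n * C n * z ^ n)" for n
      proof (cases "n = 0")
        case True
        have "complex_of_real (1 - \<beta>) * of_real (1 / (1 - \<beta>)) = 1"
          using \<open>\<beta> < 1\<close> by (simp flip: of_real_mult)
        then have "(1 - complex_of_real \<beta>) * d 0 = 1" unfolding d0 by simp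
        with True show ?thesis by (simp add: A0 c0 C_def M0 mult.assoc)
      next
        case False
        have "complex_of_real ((1 + \<mu> * real n) * (1 + \<nu> * real n)) * of_real (\<kappa> n) = of_real ((1 + \<xi> * real n) * M n)"
          unfolding of_real_mult[symmetric] \<kappa> ..
        then have "complex_of_real ((1 + \<mu> * real n) * (1 + \<nu> * real n)) * A n * d n = kernel_coeff \<sigma> \<epsilon> n * C n"
          using False unfolding d_def C_def by (simp add: mult_ac)
        with False show ?thesis by (simp add: mult.assoc)
      qed
      with sums_mult[OF Ts, of "exp (\<i> * of_real \<phi>)"]
      show "(\<lambda>n. exp (\<i> * of_real \<phi>) * (of_real ((1 + \<mu> * real n) * (1 + \<nu> * real n)) * A n - (if n = 0 then of_real \<beta> else 0)) * d n * z ^ n)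
         sums (exp (\<i> * of_real \<phi>) * T)" by (simp only:)
    qed
    then have "T \<noteq> 0" by (metis less_irrefl mult_zero_right zero_complex.sel(1))
    then show "kk z + (1 + \<epsilon>) / of_real (2 - 2 * \<sigma>) * (z * deriv kk z) \<noteq> 0" unfolding T_def .
  qed
qed

end
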